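(* Let $V$ be a positive-dimensional vector space over an algebraically closed field, let $G=GL(V)$, and let $e\geq1$. The set of tuples $(g_1,\dots,g_e)\in G^e$ such that $\langle g_1,\dots,g_e\rangle$ acts primitively on $V$ is a Zariski open subset of $G^e$.
   Context: A group acts primitively on $V$ if it acts irreducibly and preserves no decomposition $V=V_1\oplus\dots\oplus V_t$ with $t>1$ into nonzero subspaces that it permutes. *)

theory Defs
  imports "HOL-Analysis.Analysis"
begin

definition alg_closed_field :: "'a::field itself \<Rightarrow> bool" where
  "alg_closed_field _ \<longleftrightarrow> (\<forall>p :: 'a poly. 0 < degree p \<longrightarrow> (\<exists>x. poly p x = 0))"

inductive_set polyfun :: "(('v \<Rightarrow> 'a::comm_ring_1) \<Rightarrow> 'a) set" where
  const: "(\<lambda>x. c) \<in> polyfun"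
| var: "(\<lambda>x. x v) \<in> polyfun"
| add: "f \<in> polyfun \<Longrightarrow> g \<in> polyfun \<Longrightarrow> (\<lambda>x. f x + g x) \<in> polyfun"
| mult: "f \<in> polyfun \<Longrightarrow> g \<in> polyfun \<Longrightarrow> (\<lambda>x. f x * g x) \<in> polyfun"

definition zariski_closed :: "(('v \<Rightarrow> 'a::comm_ring_1)) set \<Rightarrow> bool" where
  "zariski_closed Z \<longleftrightarrow> (\<exists>F. F \<subseteq> polyfun \<and> Z = {x. \<forall>f\<in>F. f x = 0})"

definition zariski_open :: "(('v \<Rightarrow> 'a::comm_ring_1)) set \<Rightarrow> bool" where
  "zariski_open U \<longleftrightarrow> zariski_closed (- U)"

definition mat_coords :: "('e \<Rightarrow> 'a^'n^'n) \<Rightarrow> ('e \<times> 'n \<times> 'n \<Rightarrow> 'a)" where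
  "mat_coords g = (\<lambda>(i, r, c). g i $ r $ c)"

definition GL_tuples :: "('e \<Rightarrow> ('a::field)^'n^'n) set" where
  "GL_tuples = {g. \<forall>i. invertible (g i)}"

text \<open>Zariski open subsets of G^e: traces of Zariski open subsets of the ambient
  matrix space (GL_n is a principal open subset of M_n).\<close>
definition zariski_open_in_GL_tuples :: "('e \<Rightarrow> ('a::field)^'n^'n) set \<Rightarrow> bool" where
  "zariski_open_in_GL_tuples S \<longleftrightarrow>
     (\<exists>U. zariski_open U \<and> S = {g \<in> GL_tuples. mat_coords g \<in> U})"

inductive_set gen_group :: "(('a::field)^'n^'n) set \<Rightarrow> ('a^'n^'n) set" for S where
  one: "mat 1 \<in> gen_group S"
| gen: "g \<in> S \<Longrightarrow> g \<in> gen_group S"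
| inv: "g \<in> S \<Longrightarrow> matrix_inv g \<in> gen_group S"
| mult: "a \<in> gen_group S \<Longrightarrow> b \<in> gen_group S \<Longrightarrow> a ** b \<in> gen_group S"

definition acts_irreducibly :: "(('a::field)^'n^'n) set \<Rightarrow> bool" where
  "acts_irreducibly H \<longleftrightarrow>
     (\<forall>W. vec.subspace W \<and> (\<forall>h\<in>H. \<forall>v\<in>W. h *v v \<in> W) \<longrightarrow> W = {0} \<or> W = UNIV)"

definition imprimitivity_system :: "(('a::field)^'n^'n) set \<Rightarrow> ('a^'n) set set \<Rightarrow> bool" where
  "imprimitivity_system H D \<longleftrightarrow>
     finite D \<and> card D > 1 \<and>
     (\<forall>W\<in>D. vec.subspace W \<and> W \<noteq> {0}) \<and>
     vec.span (\<Union>D) = UNIV \<and>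
     (\<forall>W\<in>D. W \<inter> vec.span (\<Union>(D - {W})) = {0}) \<and>
     (\<forall>h\<in>H. \<forall>W\<in>D. (\<lambda>v. h *v v) ` W \<in> D)"

definition acts_primitively :: "(('a::field)^'n^'n) set \<Rightarrow> bool" where
  "acts_primitively H \<longleftrightarrow> acts_irreducibly H \<and> \<not> (\<exists>D. imprimitivity_system H D)"

end

theory Submission
  imports Defs
begin

text \<open>
  By Burnside's theorem (proved here through Schur's lemma and density), an algebra acting on a
  simple module of dimension \<open>k\<close> induces all of its endomorphisms. Hence the Capelli polynomial in
  \<open>d\<^sup>2 + 1\<close> alternating variables vanishes on a simple module iff its dimension is at most \<open>d\<close>, and
  the existence of a nonzero invariant subspace of dimension at most \<open>d\<close> becomes the linear
  condition that all values of the Capelli polynomial have a common kernel vector; this is a closed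
  condition on the generators. So the elimination theory of Grassmannians is avoided.

  A tuple of invertible matrices generates a reducible group iff it has an invariant subspace of
  dimension at most \<open>n - 1\<close>. If the group is irreducible and imprimitive with blocks
  \<open>V\<^sub>1, \<dots>, V\<^sub>t\<close>, the generators permute \<open>t \<le> n\<close> blocks of dimension \<open>n / t\<close> transitively, and the
  words whose permutation fixes the first block leave it invariant. Conversely, given a transitive
  action on \<open>t > 1\<close> points and a nonzero subspace of dimension at most \<open>n / t\<close> invariant under the
  words fixing a point, its translates span by irreducibility, so by counting dimensions their sum
  is direct. Positive words suffice throughout, since an invertible map sending a
  finite-dimensional subspace into itself preserves it. As there are finitely many such actions,
  the non-primitive tuples form a finite union of closed sets.
\<close>

subsection \<open>Density and Burnside's theorem\<close>

text \<open>Gaussian elimination, with \<open>f i j\<close> the coefficient of unknown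
  \<open>i\<close> in equation \<open>j\<close>: a pivot \<open>k\<close> clears equation
  \<open>j\<close> from the others, the induction solves these for the remaining unknowns, and
  equation \<open>j\<close> then fixes the value at \<open>k\<close>.\<close>

lemma homogeneous_system_nontrivial_solution:
  fixes f :: "'i \<Rightarrow> 'j \<Rightarrow> 'a::field"
  assumes "finite J" "finite I" "card J < card I"
  shows "\<exists>c. (\<exists>i\<in>I. c i \<noteq> 0) \<and> (\<forall>j\<in>J. (\<Sum>i\<in>I. c i * f i j) = 0)"
  using assms
proof (induction J arbitrary: I f rule: finite_induct)
  case empty
  then show ?case by (intro exI[of _ "\<lambda>_. 1"]) (auto simp: card_gt_0_iff)
next
  case (insert j J)
  show ?case
  proof (cases "\<forall>i\<in>I. f i j = 0")
    case True
    then show ?thesis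
      using insert.IH[of I f] insert.prems insert.hyps by (auto intro!: sum.neutral)
  next
    case False
    then obtain k where k: "k \<in> I" "f k j \<noteq> 0" by auto
    let ?I = "I - {k}"
    let ?g = "\<lambda>i l. f i l - f i j / f k j * f k l"
    have "card J < card ?I"
      using insert.prems insert.hyps k by (simp add: card_Diff_singleton_if)
    with insert.IH[of ?I ?g] insert.prems obtain c
      where c: "\<exists>i\<in>?I. c i \<noteq> 0" "\<And>l. l \<in> J \<Longrightarrow> (\<Sum>i\<in>?I. c i * ?g i l) = 0" by auto
    define s where "s = (\<Sum>i\<in>?I. c i * f i j)"
    define c' where "c' = c(k := - s / f k j)"
    have split: "(\<Sum>i\<in>I. c' i * f i l) = (\<Sum>i\<in>?I. c i * f i l) - s / f k j * f k l" for l
    proof -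
      have "(\<Sum>i\<in>I. c' i * f i l) = c' k * f k l + (\<Sum>i\<in>?I. c' i * f i l)"
        using k insert.prems by (simp add: sum.remove)
      also have "(\<Sum>i\<in>?I. c' i * f i l) = (\<Sum>i\<in>?I. c i * f i l)"
        by (rule sum.cong) (auto simp: c'_def)
      finally show ?thesis by (simp add: c'_def)
    qed
    have "(\<Sum>i\<in>I. c' i * f i l) = 0" if "l \<in> insert j J" for l
    proof (cases "l = j")
      case True
      then show ?thesis using k by (simp add: split s_def)
    next
      case False
      then have "0 = (\<Sum>i\<in>?I. c i * ?g i l)" using that c(2)[of l] by simp
      also have "\<dots> = (\<Sum>i\<in>?I. c i * f i l - c i * f i j * (f k l / f k j))"
        by (rule sum.cong) (auto simp: algebra_simps)
      also have "\<dots> = (\<Sum>i\<in>?I. c i * f i l) - s / f k j * f k l"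
        by (simp add: sum_subtractf s_def sum_distrib_right sum_divide_distrib mult.assoc)
      finally show ?thesis by (simp add: split)
    qed
    moreover have "\<exists>i\<in>I. c' i \<noteq> 0"
      using c(1) by (auto simp: c'_def)
    ultimately show ?thesis by blast
  qed
qed

definition invariant_under :: "('a::field^'n^'n) set \<Rightarrow> ('a^'n) set \<Rightarrow> bool" where
  "invariant_under A W \<longleftrightarrow> (\<forall>a\<in>A. \<forall>v\<in>W. a *v v \<in> W)"

lemma invariant_underD: "invariant_under A W \<Longrightarrow> a \<in> A \<Longrightarrow> v \<in> W \<Longrightarrow> a *v v \<in> W"
  by (simp add: invariant_under_def)

text \<open>Only the values on \<open>W\<close> are constrained: the endomorphism to which Schur's
  lemma is applied is built by choice and is meaningful on \<open>W\<close> only.\<close>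

definition linear_on_subspace :: "('a::field^'n) set \<Rightarrow> ('a^'n \<Rightarrow> 'a^'n) \<Rightarrow> bool" where
  "linear_on_subspace W T \<longleftrightarrow>
     (\<forall>x\<in>W. T x \<in> W) \<and> (\<forall>x\<in>W. \<forall>y\<in>W. T (x + y) = T x + T y) \<and> (\<forall>c. \<forall>x\<in>W. T (c *s x) = c *s T x)"

lemma linear_on_subspace_sum:
  assumes W: "vec.subspace W" and T: "linear_on_subspace W T"
    and "finite I" "\<And>i. i \<in> I \<Longrightarrow> x i \<in> W"
  shows "T (\<Sum>i\<in>I. c i *s x i) = (\<Sum>i\<in>I. c i *s T (x i))"
  using assms(3,4)
proof (induction I rule: finite_induct)
  case empty
  have "T (0 *s 0) = 0 *s T 0"
    using T vec.subspace_0[OF W] unfolding linear_on_subspace_def by blast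
  then show ?case by simp
next
  case (insert i I)
  have "(\<Sum>i\<in>I. c i *s x i) \<in> W" "c i *s x i \<in> W"
    using insert.prems W by (auto intro!: vec.subspace_sum vec.subspace_scale)
  then show ?case using insert T by (simp add: linear_on_subspace_def)
qed

text \<open>The annihilator of a nonzero vector contains a polynomial of minimal degree; dividing it
  by a linear factor leaves a polynomial whose value at the operator sends the vector to an
  eigenvector.\<close>
lemma exists_eigenvector_in_subspace:
  fixes W :: "('a::field^'n) set"
  assumes ac: "alg_closed_field TYPE('a)" and W: "vec.subspace W" "W \<noteq> {0}"
    and T: "linear_on_subspace W T"
  obtains x c where "x \<in> W" "x \<noteq> 0" "T x = c *s x"
proof -
  obtain w where w: "w \<in> W" "w \<noteq> 0" using W vec.subspace_0[OF W(1)] by auto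
  have iter: "(T ^^ i) w \<in> W" for i
    using w T by (induction i) (auto simp: linear_on_subspace_def)
  \<comment> \<open>\<open>ev p\<close> is p(T) w.\<close>
  define ev where "ev p = (\<Sum>i\<le>degree p. coeff p i *s (T ^^ i) w)" for p
  have ev: "ev p = (\<Sum>i\<le>N. coeff p i *s (T ^^ i) w)" if "degree p \<le> N" for p N
    unfolding ev_def by (rule sum.mono_neutral_left) (use that in \<open>auto simp: coeff_eq_0\<close>)
  have evW: "ev p \<in> W" for p
    unfolding ev_def using iter W by (intro vec.subspace_sum vec.subspace_scale) auto
  have ex: "\<exists>p. p \<noteq> 0 \<and> ev p = 0"
  proof -
    \<comment> \<open>The \<open>CARD('n) + 1\<close> vectors w, T w, T^2 w, ... are linearly
      dependent; a relation between them is a polynomial annihilating \<open>w\<close>.\<close>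
    obtain c where c: "\<exists>i\<in>{..CARD('n)}. c i \<noteq> 0"
      "\<And>j. (\<Sum>i\<le>CARD('n). c i * (T ^^ i) w $ j) = 0"
      using homogeneous_system_nontrivial_solution[of "UNIV :: 'n set" "{..CARD('n)}" "\<lambda>i j. (T ^^ i) w $ j"]
      by auto
    define p where "p = (\<Sum>i\<le>CARD('n). monom (c i) i)"
    have co: "coeff p i = (if i \<le> CARD('n) then c i else 0)" for i
      by (simp add: p_def coeff_sum)
    have "p \<noteq> 0"
      using c(1) co by (metis atMost_iff coeff_0)
    moreover have "degree p \<le> CARD('n)"
      by (rule degree_le) (simp add: co)
    then have "ev p = 0"
      using c(2) by (auto simp: ev vec_eq_iff co)
    ultimately show ?thesis by blast
  qed
  define P where "P p \<longleftrightarrow> p \<noteq> 0 \<and> ev p = 0" for p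
  obtain p0 where "P p0" using ex by (auto simp: P_def)
  from arg_min_nat_lemma[of P, OF this, of degree]
  obtain p where p: "p \<noteq> 0" "ev p = 0" and min: "\<And>q. q \<noteq> 0 \<Longrightarrow> ev q = 0 \<Longrightarrow> degree p \<le> degree q"
    by (auto simp: P_def)
  have "degree p \<noteq> 0"
  proof
    assume "degree p = 0"
    then obtain c where "p = [:c:]" by (rule degree_eq_zeroE)
    then show False using p w by (auto simp: ev_def)
  qed
  then obtain c where "poly p c = 0" using ac by (auto simp: alg_closed_field_def)
  then obtain q where q: "p = [:- c, 1:] * q" by (auto simp: poly_eq_0_iff_dvd elim: dvdE)
  have q0: "q \<noteq> 0" using p q by auto
  have dq: "degree p = Suc (degree q)" unfolding q using q0 by (subst degree_mult_eq) auto
  have "ev q \<noteq> 0" using min[OF q0] dq by auto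
  moreover have "T (ev q) = c *s ev q"
  proof -
    let ?N = "degree q"
    have cp: "coeff p i = coeff (pCons 0 q) i - c * coeff q i" for i
      by (simp add: q)
    have "ev p = (\<Sum>i\<le>Suc ?N. coeff p i *s (T ^^ i) w)" using dq by (simp add: ev_def)
    also have "\<dots> = (\<Sum>i\<le>Suc ?N. coeff (pCons 0 q) i *s (T ^^ i) w) - c *s (\<Sum>i\<le>Suc ?N. coeff q i *s (T ^^ i) w)"
      by (simp only: cp vec.scale_sum_right sum_subtractf[symmetric] vec.scale_left_diff_distrib vec.scale_scale)
    also have "(\<Sum>i\<le>Suc ?N. coeff q i *s (T ^^ i) w) = ev q" by (simp add: ev[of q "Suc ?N"])
    \<comment> \<open>Multiplying \<open>q\<close> by the indeterminate shifts its coefficients,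
      which amounts to one more application of \<open>T\<close>.\<close>
    also have "(\<Sum>i\<le>Suc ?N. coeff (pCons 0 q) i *s (T ^^ i) w) = (\<Sum>i\<le>?N. coeff q i *s T ((T ^^ i) w))"
      by (simp only: sum.atMost_Suc_shift) simp
    also have "\<dots> = T (ev q)"
      unfolding ev_def using iter by (simp add: linear_on_subspace_sum[OF W(1) T])
    finally show ?thesis using p by simp
  qed
  ultimately show thesis using that evW by blast
qed

text \<open>Closure under scalar multiplication comes from products with the scalar matrices
  \<open>mat c\<close>.\<close>

definition mat_algebra :: "('a::field^'n^'n) set \<Rightarrow> bool" where
  "mat_algebra A \<longleftrightarrow> (\<forall>c. mat c \<in> A) \<and> (\<forall>a\<in>A. \<forall>b\<in>A. a + b \<in> A \<and> a ** b \<in> A)"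

definition simple_module :: "('a::field^'n^'n) set \<Rightarrow> ('a^'n) set \<Rightarrow> bool" where
  "simple_module A W \<longleftrightarrow> vec.subspace W \<and> W \<noteq> {0} \<and> invariant_under A W \<and>
     (\<forall>U. vec.subspace U \<and> U \<subseteq> W \<and> invariant_under A U \<longrightarrow> U = {0} \<or> U = W)"

lemma mat_scalar_mult [simp]: "mat c *v v = c *s (v :: 'a::field^'n)"
  by (simp add: vec_eq_iff matrix_vector_mult_def mat_def if_distrib if_distribR sum.delta' cong: if_cong)

text \<open>A nonzero invariant subspace of \<open>U\<close> of least dimension is simple.\<close>

lemma exists_simple_submodule:
  fixes U :: "('a::field^'n) set"
  assumes "vec.subspace U" "U \<noteq> {0}" "invariant_under A U"
  obtains W where "simple_module A W" "W \<subseteq> U"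
proof -
  define P where "P W \<longleftrightarrow> vec.subspace W \<and> W \<noteq> {0} \<and> invariant_under A W \<and> W \<subseteq> U" for W
  have "P U" using assms by (simp add: P_def)
  then obtain W where W: "P W" and min: "\<And>X. P X \<Longrightarrow> vec.dim W \<le> vec.dim X"
    using arg_min_nat_lemma[of P U vec.dim] by metis
  have "X = {0} \<or> X = W" if "vec.subspace X" "X \<subseteq> W" "invariant_under A X" for X
    using that W min[of X] vec.subspace_dim_equal[of X W] unfolding P_def by blast
  then show thesis using W that[of W] unfolding simple_module_def P_def by blast
qed

text \<open>An eigenspace of \<open>T\<close> is a nonzero submodule, because \<open>T\<close>
  commutes with \<open>A\<close>; by simplicity it is all of \<open>W\<close>.\<close>

lemma schur_scalar:
  fixes W :: "('a::field^'n) set"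
  assumes ac: "alg_closed_field TYPE('a)" and W: "simple_module A W"
    and T: "linear_on_subspace W T"
    and comm: "\<And>a x. a \<in> A \<Longrightarrow> x \<in> W \<Longrightarrow> T (a *v x) = a *v T x"
  obtains c where "\<And>x. x \<in> W \<Longrightarrow> T x = c *s x"
proof -
  have sW: "vec.subspace W" "W \<noteq> {0}" and iW: "invariant_under A W"
    using W by (auto simp: simple_module_def)
  obtain x c where x: "x \<in> W" "x \<noteq> 0" "T x = c *s x"
    using exists_eigenvector_in_subspace[OF ac sW T] .
  define U where "U = {y \<in> W. T y = c *s y}"
  have "T 0 = 0" using linear_on_subspace_sum[OF sW(1) T, of "{}"] by simp
  then have "vec.subspace U"
    using T sW(1) by (auto simp: vec.subspace_def U_def linear_on_subspace_def
        vec.scale_right_distrib vec.scale_left_commute)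
  moreover have "invariant_under A U"
    using iW comm by (auto simp: invariant_under_def U_def vector_scalar_commute)
  ultimately have "U = W"
    using W x by (auto simp: simple_module_def U_def)
  then show thesis using that by (auto simp: U_def)
qed

text \<open>For a left ideal \<open>I\<close>, the set I u is a submodule of \<open>W\<close>, and
  it is nonzero because of \<open>a\<close>. It serves both for \<open>I = A\<close> and for the
  annihilator of finitely many vectors.\<close>

lemma simple_module_orbit:
  assumes W: "simple_module A W" and A: "mat_algebra A"
    and I: "I \<subseteq> A" "\<And>a b. a \<in> I \<Longrightarrow> b \<in> I \<Longrightarrow> a + b \<in> I" "\<And>a b. a \<in> A \<Longrightarrow> b \<in> I \<Longrightarrow> a ** b \<in> I"
    and a: "a \<in> I" "u \<in> W" "a *v u \<noteq> 0"
  shows "(\<lambda>b. b *v u) ` I = W"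
proof -
  let ?U = "(\<lambda>b. b *v u) ` I"
  have "mat 0 ** a \<in> I" using I(3)[of "mat 0" a] a A unfolding mat_algebra_def by blast
  moreover have "(mat 0 ** a) *v u = 0" by (simp only: matrix_vector_mul_assoc[symmetric] mat_scalar_mult) simp
  ultimately have "0 \<in> ?U" by (metis image_eqI)
  moreover have "c *s (b *v u) \<in> ?U" if "b \<in> I" for c b
  proof
    show "c *s (b *v u) = (mat c ** b) *v u" by (simp add: matrix_vector_mul_assoc[symmetric])
    show "mat c ** b \<in> I" using A that I by (auto simp: mat_algebra_def)
  qed
  moreover have "b *v u + b' *v u \<in> ?U" if "b \<in> I" "b' \<in> I" for b b'
    using I(2)[OF that] by (auto simp: matrix_vector_mult_add_rdistrib intro!: image_eqI[of _ _ "b + b'"])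
  ultimately have "vec.subspace ?U" by (auto simp: vec.subspace_def)
  moreover have "?U \<subseteq> W"
    using W I(1) a(2) by (auto simp: simple_module_def invariant_under_def)
  moreover have "invariant_under A ?U"
    using I(3) by (auto simp: invariant_under_def matrix_vector_mul_assoc)
  ultimately have "?U = {0} \<or> ?U = W" using W by (simp add: simple_module_def)
  moreover have "?U \<noteq> {0}" using a by blast
  ultimately show ?thesis by blast
qed

text \<open>The inductive step of the density theorem: if no element of the annihilator \<open>I\<close> of \<open>B\<close>
  separated \<open>w\<close> from \<open>u\<close>, then \<open>a u \<mapsto> a w\<close> (\<open>a\<close> in \<open>I\<close>) would be a well-defined module
  endomorphism, hence a scalar \<open>c\<close>, and \<open>I\<close> would annihilate \<open>w - c u\<close>.\<close>
lemma density_separation: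
  fixes W :: "('a::field^'n) set"
  assumes ac: "alg_closed_field TYPE('a)" and W: "simple_module A W" and A: "mat_algebra A"
    and "finite B" "B \<subseteq> W" "w \<in> W" "w \<notin> vec.span B"
  shows "\<exists>a\<in>A. (\<forall>b\<in>B. a *v b = 0) \<and> a *v w \<noteq> 0"
  using assms(4-7)
proof (induction B arbitrary: w rule: finite_induct)
  case empty
  then show ?case using A by (intro bexI[of _ "mat 1"]) (auto simp: mat_algebra_def)
next
  case (insert u B)
  have sW: "vec.subspace W" and iW: "invariant_under A W"
    using W by (auto simp: simple_module_def)
  show ?case
  proof (cases "u \<in> vec.span B")
    case True
    \<comment> \<open>A dependent vector \<open>u\<close> changes neither the span nor the
      annihilator.\<close>
    then have "vec.span (insert u B) = vec.span B" by (rule vec.span_redundant)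
    then obtain a where a: "a \<in> A" "\<forall>b\<in>B. a *v b = 0" "a *v w \<noteq> 0"
      using insert.IH[of w] insert.prems by auto
    have "vec.subspace {x. a *v x = 0}"
      by (auto simp: vec.subspace_def matrix_vector_right_distrib vector_scalar_commute)
    then have "a *v u = 0"
      using True a(2) vec.span_minimal[of B "{x. a *v x = 0}"] by auto
    with a show ?thesis by auto
  next
    case False
    show ?thesis
    proof (rule ccontr)
      assume neg: "\<not> ?thesis"
      define I where "I = {a \<in> A. \<forall>b\<in>B. a *v b = 0}"
      have kill: "a *v w = 0" if "a \<in> I" "a *v u = 0" for a
        using neg that by (auto simp: I_def)
      obtain a where a: "a \<in> I" "a *v u \<noteq> 0"
        using insert.IH[of u] insert.prems False by (auto simp: I_def)
      have I: "I \<subseteq> A" "\<And>a b. a \<in> I \<Longrightarrow> b \<in> I \<Longrightarrow> a + b \<in> I" "\<And>a b. a \<in> A \<Longrightarrow> b \<in> I \<Longrightarrow> a ** b \<in> I"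
        using A by (auto simp: I_def mat_algebra_def matrix_vector_mult_add_rdistrib
            matrix_vector_mul_assoc[symmetric])
      have orb: "(\<lambda>b. b *v u) ` I = W"
        by (rule simple_module_orbit[OF W A I a(1) _ a(2)]) (use insert.prems in auto)
      \<comment> \<open>\<open>f x\<close> is some element of \<open>I\<close> carrying
        \<open>u\<close> to \<open>x\<close>; by \<open>kill\<close>, the choice does not affect its
        value on \<open>w\<close>.\<close>
      define f where "f x = (SOME b. b \<in> I \<and> b *v u = x)" for x
      have f: "f x \<in> I" "f x *v u = x" if "x \<in> W" for x
      proof -
        have "\<exists>b. b \<in> I \<and> b *v u = x" using that orb by auto
        then show "f x \<in> I" "f x *v u = x" unfolding f_def by (metis (mono_tags, lifting) someI_ex)+
      qed
      define T where "T x = f x *v w" for x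
      have T: "T x = b *v w" if "b \<in> I" "b *v u = x" "x \<in> W" for b x
      proof -
        have "f x + mat (-1) ** b \<in> I" using f that I A by (auto simp: mat_algebra_def)
        moreover have "(f x + mat (-1) ** b) *v u = 0"
          using f that by (simp add: matrix_vector_mult_add_rdistrib matrix_vector_mul_assoc[symmetric])
        ultimately have "(f x + mat (-1) ** b) *v w = 0" by (rule kill)
        then show ?thesis
          by (simp add: T_def matrix_vector_mult_add_rdistrib matrix_vector_mul_assoc[symmetric])
      qed
      have TI: "T x = f x *v w" for x by (simp add: T_def)
      have comm: "T (b *v x) = b *v T x" if "b \<in> A" "x \<in> W" for b x
      proof -
        have "T (b *v x) = (b ** f x) *v w"
          by (rule T) (use that I f iW in \<open>auto simp: matrix_vector_mul_assoc[symmetric] invariant_under_def\<close>)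
        then show ?thesis by (simp add: TI matrix_vector_mul_assoc)
      qed
      have "T (x + y) = T x + T y" if "x \<in> W" "y \<in> W" for x y
      proof -
        have "T (x + y) = (f x + f y) *v w"
          by (rule T) (use that I f sW in \<open>auto simp: matrix_vector_mult_add_rdistrib vec.subspace_add\<close>)
        then show ?thesis by (simp add: TI matrix_vector_mult_add_rdistrib)
      qed
      moreover have "T (c *s x) = c *s T x" if "x \<in> W" for x c
        using comm[of "mat c" x] that A by (simp add: mat_algebra_def)
      moreover have "T x \<in> W" if "x \<in> W" for x
        unfolding TI using f[OF that] I iW insert.prems by (auto simp: invariant_under_def)
      ultimately have "linear_on_subspace W T" by (auto simp: linear_on_subspace_def)
      from schur_scalar[OF ac W this comm] obtain c where c: "\<And>x. x \<in> W \<Longrightarrow> T x = c *s x" by blast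
      have 0: "b *v (w - c *s u) = 0" if "b \<in> I" for b
      proof -
        have bu: "b *v u \<in> W" using orb that by auto
        have "b *v w = T (b *v u)" using T[OF that refl bu] by simp
        also have "\<dots> = c *s (b *v u)" by (rule c[OF bu])
        finally show ?thesis by (simp add: matrix_vector_mult_diff_distrib vector_scalar_commute)
      qed
      \<comment> \<open>As \<open>w\<close> lies outside the span of \<open>insert u B\<close>, the
        induction hypothesis applies to \<open>w - c *s u\<close> and contradicts that
        \<open>I\<close> annihilates this vector.\<close>
      have "w - c *s u \<notin> vec.span B"
        using insert.prems by (auto simp: vec.span_breakdown_eq)
      moreover have "w - c *s u \<in> W"
        using insert.prems sW by (auto intro!: vec.subspace_diff vec.subspace_scale)
      ultimately show False
        using insert.IH[of "w - c *s u"] insert.prems 0 by (auto simp: I_def)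
    qed
  qed
qed

text \<open>Density gives an element of \<open>A\<close> that kills the rest of \<open>B\<close> but
  not \<open>q\<close>; by simplicity a second element moves the image of \<open>q\<close> to
  \<open>p\<close>.\<close>

lemma simple_module_matrix_unit:
  fixes W :: "('a::field^'n) set"
  assumes ac: "alg_closed_field TYPE('a)" and W: "simple_module A W" and A: "mat_algebra A"
    and B: "B \<subseteq> W" "vec.independent B" and "p \<in> W" "q \<in> B"
  shows "\<exists>a\<in>A. a *v q = p \<and> (\<forall>r\<in>B - {q}. a *v r = 0)"
proof -
  have fin: "finite B" using B(2) by (rule vec.finiteI_independent)
  have "q \<notin> vec.span (B - {q})" using B assms(7) by (auto simp: vec.dependent_def)
  then obtain a where a: "a \<in> A" "\<forall>b\<in>B - {q}. a *v b = 0" "a *v q \<noteq> 0"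
    using density_separation[OF ac W A, of "B - {q}" q] fin B assms(7) by auto
  have aq: "a *v q \<in> W"
    using W a(1) B assms(7) by (auto simp: simple_module_def invariant_under_def)
  have "(\<lambda>b. b *v (a *v q)) ` A = W"
    by (rule simple_module_orbit[OF W A, where a = "mat 1"])
      (use A aq a in \<open>auto simp: mat_algebra_def\<close>)
  then obtain b where "b \<in> A" "b *v (a *v q) = p" using assms(6) by auto
  then show ?thesis
    using A a by (intro bexI[of _ "b ** a"]) (auto simp: mat_algebra_def matrix_vector_mul_assoc[symmetric])
qed

subsection \<open>Capelli polynomials\<close>

text \<open>Unrolled, this is \<open>b n ** x (n - 1) ** b (n - 1) ** ... ** x 0 ** b 0\<close>:
  there is one more separator \<open>b\<close> than there are variables \<open>x\<close>.\<close>

primrec chain :: "(nat \<Rightarrow> 'a::field^'n^'n) \<Rightarrow> (nat \<Rightarrow> 'a^'n^'n) \<Rightarrow> nat \<Rightarrow> 'a^'n^'n" where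
  "chain b x 0 = b 0"
| "chain b x (Suc n) = b (Suc n) ** x n ** chain b x n"

text \<open>The Capelli polynomial, multilinear and alternating in \<open>x 0\<close>, ...,
  \<open>x (N - 1)\<close>, with free separators \<open>b 0\<close>, ...,
  \<open>b N\<close>.\<close>

definition capelli :: "nat \<Rightarrow> (nat \<Rightarrow> 'a::field^'n^'n) \<Rightarrow> (nat \<Rightarrow> 'a^'n^'n) \<Rightarrow> 'a^'n^'n" where
  "capelli N b x = (\<Sum>p | p permutes {..<N}. mat (of_int (sign p)) ** chain b (x \<circ> p) N)"

lemma matrix_vector_mult_sum_left: "(\<Sum>i\<in>I. f i) *v v = (\<Sum>i\<in>I. f i *v (v :: 'a::field^'n))"
  by (induction I rule: infinite_finite_induct) (auto simp: matrix_vector_mult_add_rdistrib)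

lemma capelli_vector:
  "capelli N b x *v v = (\<Sum>p | p permutes {..<N}. of_int (sign p) *s (chain b (x \<circ> p) N *v v))"
  by (simp add: capelli_def matrix_vector_mult_sum_left matrix_vector_mul_assoc[symmetric])

lemma chain_cong: "(\<And>i. i < n \<Longrightarrow> x i = y i) \<Longrightarrow> chain b x n = chain b y n"
  by (induction n) auto

lemma chain_mult_right: "chain b x n ** c = chain (b(0 := b 0 ** c)) x n"
  by (induction n) (auto simp: matrix_mul_assoc[symmetric])

lemma invariant_chain:
  assumes "invariant_under A W" "\<And>i. b i \<in> A" "\<And>i. x i \<in> A" "v \<in> W"
  shows "chain b x n *v v \<in> W"
  using assms by (induction n) (auto simp: invariant_under_def matrix_vector_mul_assoc[symmetric])

text \<open>The relation for \<open>z\<close> is needed only on \<open>W\<close>, since by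
  invariance all intermediate vectors stay there.\<close>

lemma chain_linear_at:
  assumes A: "invariant_under A W" "\<And>i. b i \<in> A" "\<And>i. x i \<in> A" "v \<in> W"
    and z: "\<And>w. w \<in> W \<Longrightarrow> z *v w = (\<Sum>i\<in>I. c i *s (y i *v w))" and "j < n"
  shows "chain b (x(j := z)) n *v v = (\<Sum>i\<in>I. c i *s (chain b (x(j := y i)) n *v v))"
  using assms(6)
proof (induction n)
  case (Suc n)
  show ?case
  proof (cases "j = n")
    case True
    have eq: "chain b (x(j := u)) n = chain b x n" for u
      by (rule chain_cong) (use True in auto)
    have "chain b x n *v v \<in> W" by (rule invariant_chain[OF A])
    moreover have "chain b (x(j := u)) (Suc n) *v v = b (Suc n) *v (u *v (chain b x n *v v))" for u
      using eq[of u] by (simp only: chain.simps True fun_upd_same matrix_vector_mul_assoc[symmetric])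
    ultimately show ?thesis
      using z by (simp only: vec.sum vec.scale)
  next
    case False
    then have "j < n" using Suc.prems by simp
    from Suc.IH[OF this] show ?thesis
      using False by (simp add: matrix_vector_mul_assoc[symmetric] vec.sum vec.scale)
  qed
qed simp

text \<open>Composition with the transposition matches even with odd permutations of equal value.
  Cancelling these pairs, instead of equating the sum with its negative, also covers characteristic
  2.\<close>

lemma alternating_sum_eq_0:
  fixes f :: "(nat \<Rightarrow> nat) \<Rightarrow> 'a::field^'n"
  assumes ij: "i < N" "j < N" "i \<noteq> j"
    and f: "\<And>p. f (Transposition.transpose i j \<circ> p) = f p"
  shows "(\<Sum>p | p permutes {..<N}. of_int (sign p) *s f p) = 0"
proof -
  let ?S = "{p. p permutes {..<N}}" and ?t = "Transposition.transpose i j"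
  let ?E = "{p \<in> ?S. evenperm p}" and ?O = "{p \<in> ?S. \<not> evenperm p}"
  have fin: "finite ?S" by (simp add: finite_permutations)
  have tp: "?t permutes {..<N}" using ij by (intro permutes_swap_id) auto
  have tt: "?t \<circ> (?t \<circ> p) = p" for p by (simp add: fun_eq_iff)
  have ev: "evenperm (?t \<circ> p) \<longleftrightarrow> \<not> evenperm p" if "p \<in> ?S" for p
  proof -
    have "permutation p" using that by (auto simp: permutation_permutes)
    then show ?thesis using ij by (simp add: evenperm_comp permutation_swap_id evenperm_swap)
  qed
  have "(\<Sum>p\<in>?O. f p) = (\<Sum>p\<in>?E. f p)"
    by (rule sum.reindex_bij_witness[of _ "\<lambda>p. ?t \<circ> p" "\<lambda>p. ?t \<circ> p"])
      (use ev tp in \<open>auto simp: tt f permutes_compose\<close>)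
  moreover have "(\<Sum>p\<in>?S. of_int (sign p) *s f p) =
      (\<Sum>p\<in>?E. of_int (sign p) *s f p) + (\<Sum>p\<in>?O. of_int (sign p) *s f p)"
    by (subst sum.union_disjoint[symmetric]) (auto intro!: sum.cong simp: fin)
  moreover have "(\<Sum>p\<in>?E. of_int (sign p) *s f p) = (\<Sum>p\<in>?E. f p)"
    by (rule sum.cong) (auto simp: sign_def)
  moreover have "(\<Sum>p\<in>?O. of_int (sign p) *s f p) = - (\<Sum>p\<in>?O. f p)"
    unfolding sum_negf[symmetric] by (rule sum.cong) (auto simp: sign_def)
  ultimately show ?thesis by simp
qed

lemma capelli_repeated:
  assumes "i < N" "j < N" "i \<noteq> j" "x i = x j"
  shows "capelli N b x *v v = 0"
proof -
  have eq: "x \<circ> (Transposition.transpose i j \<circ> p) = x \<circ> p" for p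
    using assms by (auto simp: fun_eq_iff Transposition.transpose_def)
  show ?thesis
    unfolding capelli_vector by (intro alternating_sum_eq_0[OF assms(1-3)]) (simp only: eq)
qed

lemma capelli_linear_at:
  assumes A: "invariant_under A W" "\<And>i. b i \<in> A" "\<And>i. x i \<in> A" "v \<in> W"
    and z: "\<And>w. w \<in> W \<Longrightarrow> z *v w = (\<Sum>i\<in>I. c i *s (y i *v w))" and "m < N"
  shows "capelli N b (x(m := z)) *v v = (\<Sum>i\<in>I. c i *s (capelli N b (x(m := y i)) *v v))"
proof -
  have 1: "chain b (x(m := z) \<circ> p) N *v v = (\<Sum>i\<in>I. c i *s (chain b (x(m := y i) \<circ> p) N *v v))"
    if p: "p permutes {..<N}" for p
  proof -
    \<comment> \<open>Variable \<open>m\<close> occupies position \<open>inv p m\<close> of the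
      permuted word.\<close>
    have eq: "x(m := u) \<circ> p = (x \<circ> p)(inv p m := u)" for u
      using permutes_inverses[OF p] by (auto simp: fun_eq_iff)
    have "inv p m < N"
      using permutes_in_image[OF permutes_inv[OF p], of m] assms(6) by simp
    then show ?thesis
      unfolding eq by (intro chain_linear_at[OF A(1,2) _ A(4) z]) (simp_all add: A)
  qed
  have "capelli N b (x(m := z)) *v v =
      (\<Sum>p | p permutes {..<N}. \<Sum>i\<in>I. of_int (sign p) *s (c i *s (chain b (x(m := y i) \<circ> p) N *v v)))"
    unfolding capelli_vector by (rule sum.cong) (simp_all only: mem_Collect_eq 1 vec.scale_sum_right)
  also have "\<dots> = (\<Sum>i\<in>I. \<Sum>p | p permutes {..<N}. of_int (sign p) *s (c i *s (chain b (x(m := y i) \<circ> p) N *v v)))"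
    by (rule sum.swap)
  also have "\<dots> = (\<Sum>i\<in>I. c i *s (capelli N b (x(m := y i)) *v v))"
    unfolding capelli_vector vec.scale_sum_right by (simp add: mult.commute)
  finally show ?thesis .
qed

text \<open>Put zero for argument \<open>m\<close> and expand it in two ways, as the empty
  combination and as the given relation. In the second expansion every term with
  \<open>i \<noteq> m\<close> repeats an argument, so \<open>c m\<close> times the value is
  zero.\<close>

lemma capelli_dependent:
  assumes A: "invariant_under A W" "\<And>i. b i \<in> A" "\<And>i. x i \<in> A" "v \<in> W"
    and dep: "\<And>w. w \<in> W \<Longrightarrow> (\<Sum>i<N. c i *s (x i *v w)) = 0" and m: "m < N" "c m \<noteq> 0"
  shows "capelli N b x *v v = 0"
proof -
  have "capelli N b (x(m := 0)) *v v = (\<Sum>i\<in>{}. 0 *s (capelli N b (x(m := x i)) *v v))"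
    by (rule capelli_linear_at[OF A _ m(1)]) auto
  moreover have "capelli N b (x(m := 0)) *v v = (\<Sum>i<N. c i *s (capelli N b (x(m := x i)) *v v))"
    by (rule capelli_linear_at[OF A _ m(1)]) (auto simp: dep)
  moreover have "\<dots> = (\<Sum>i<N. if i = m then c m *s (capelli N b x *v v) else 0)"
  proof (rule sum.cong)
    fix i assume "i \<in> {..<N}"
    then show "c i *s (capelli N b (x(m := x i)) *v v) = (if i = m then c m *s (capelli N b x *v v) else 0)"
      using m capelli_repeated[of i N m "x(m := x i)" b v] by auto
  qed simp
  ultimately show ?thesis using m by simp
qed

text \<open>The endomorphisms of \<open>W\<close> form a space of dimension at most
  \<open>d * d\<close>, so \<open>N\<close> of them are linearly dependent.\<close>

lemma capelli_small_submodule: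
  fixes W :: "('a::field^'n) set"
  assumes W: "vec.subspace W" and A: "invariant_under A W" "\<And>i. b i \<in> A" "\<And>i. x i \<in> A" "v \<in> W"
    and "vec.dim W \<le> d" "d * d < N"
  shows "capelli N b x *v v = 0"
proof -
  obtain B where B: "B \<subseteq> W" "vec.independent B" "W \<subseteq> vec.span B" "card B = vec.dim W"
    by (rule vec.basis_exists)
  have fin: "finite B" using B(2) by (rule vec.finiteI_independent)
  \<comment> \<open>\<open>f i\<close> lists the entries of the matrix of \<open>x i\<close> on
    \<open>W\<close> in the basis \<open>B\<close>.\<close>
  define f where "f i = (\<lambda>(r, s). vec.representation B (x i *v r) s)" for i
  have "card (B \<times> B) \<le> d * d" using B assms(6) by (simp add: card_cartesian_product mult_mono)
  then have "card (B \<times> B) < card {..<N}" using assms(7) by simp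
  from homogeneous_system_nontrivial_solution[OF _ _ this, of f] fin obtain c
    where c: "\<exists>i\<in>{..<N}. c i \<noteq> 0" "\<And>r s. r \<in> B \<Longrightarrow> s \<in> B \<Longrightarrow> (\<Sum>i<N. c i * f i (r, s)) = 0"
    by auto
  have 0: "(\<Sum>i<N. c i *s (x i *v r)) = 0" if "r \<in> B" for r
  proof -
    have "x i *v r = (\<Sum>s\<in>B. f i (r, s) *s s)" for i
    proof -
      have "x i *v r \<in> vec.span B" using that B invariant_underD[OF A(1) A(3)] by blast
      then show ?thesis
        unfolding f_def using vec.sum_representation_eq[OF B(2) _ fin] by simp
    qed
    then have "(\<Sum>i<N. c i *s (x i *v r)) = (\<Sum>i<N. \<Sum>s\<in>B. (c i * f i (r, s)) *s s)"
      by (simp only: vec.scale_sum_right vec.scale_scale)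
    also have "\<dots> = (\<Sum>s\<in>B. (\<Sum>i<N. c i * f i (r, s)) *s s)"
      by (subst sum.swap) (simp only: vec.scale_sum_left)
    also have "\<dots> = 0" using c(2)[OF that] by simp
    finally show ?thesis .
  qed
  \<comment> \<open>The kernel of \<open>M\<close> is a subspace containing \<open>B\<close>, hence
    \<open>W\<close>; this extends the relation from the basis to all of \<open>W\<close>.\<close>
  define M where "M = (\<Sum>i<N. mat (c i) ** x i)"
  have M: "M *v w = (\<Sum>i<N. c i *s (x i *v w))" for w
    by (simp add: M_def matrix_vector_mult_sum_left matrix_vector_mul_assoc[symmetric])
  have "vec.subspace {w. M *v w = 0}"
    by (auto simp: vec.subspace_def matrix_vector_right_distrib vector_scalar_commute)
  then have "W \<subseteq> {w. M *v w = 0}"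
    using B(3) vec.span_minimal[of B "{w. M *v w = 0}"] 0 M by auto
  then have "(\<Sum>i<N. c i *s (x i *v w)) = 0" if "w \<in> W" for w
    using that M by auto
  moreover obtain m where "m < N" "c m \<noteq> 0" using c(1) by auto
  ultimately show ?thesis by (rule capelli_dependent[where A = A and W = W and v = v and c = c, OF A])
qed

text \<open>With the matrix units \<open>x i = E (p i) (q i)\<close> and connecting factors
  \<open>E (q (i + 1)) (p i)\<close>, only the identity permutation gives a nonzero product.\<close>
lemma capelli_matrix_units:
  fixes w :: "nat \<Rightarrow> 'a::field^'n" and E :: "nat \<Rightarrow> nat \<Rightarrow> 'a^'n^'n"
  assumes E: "\<And>p q r. p < k \<Longrightarrow> q < k \<Longrightarrow> r < k \<Longrightarrow> E p q *v w r = (if q = r then w p else 0)"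
    and k: "0 < k" and N: "N \<le> k * k"
  shows "capelli N (\<lambda>i. case i of 0 \<Rightarrow> E 0 0 | Suc j \<Rightarrow> E (Suc j mod k) (j div k))
           (\<lambda>i. E (i div k) (i mod k)) *v w 0 = w (N mod k)"
proof -
  let ?b = "\<lambda>i. case i of 0 \<Rightarrow> E 0 0 | Suc j \<Rightarrow> E (Suc j mod k) (j div k)"
  let ?x = "\<lambda>i. E (i div k) (i mod k)"
  have chain: "chain ?b (?x \<circ> \<sigma>) n *v w 0 = (if \<forall>i<n. \<sigma> i = i then w (n mod k) else 0)"
    if \<sigma>: "\<sigma> permutes {..<N}" and "n \<le> N" for \<sigma> n
  proof -
    define y where "y = ?x \<circ> \<sigma>"
    have y: "y i = ?x (\<sigma> i)" for i by (simp add: y_def)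
    show ?thesis
      unfolding y_def[symmetric] using that(2)
    proof (induction n)
      case 0
      then show ?case using E k by simp
    next
      case (Suc n)
      have n: "n < N" "\<sigma> n < N" using permutes_in_image[OF \<sigma>, of n] Suc.prems by auto
      then have lt: "n div k < k" "\<sigma> n div k < k" "n mod k < k" "\<sigma> n mod k < k" "Suc n mod k < k"
        using N k by (auto simp: div_less_iff_less_mult)
      \<comment> \<open>The variable at position \<open>n\<close> does not kill
        \<open>w (n mod k)\<close> iff the remainders agree, and the separator after it does not
        kill the result iff the quotients agree.\<close>
      have eq: "\<sigma> n = n \<longleftrightarrow> \<sigma> n div k = n div k \<and> \<sigma> n mod k = n mod k"
        by (metis div_mult_mod_eq)
      show ?case
      proof (cases "\<forall>i<n. \<sigma> i = i")
        case True
        then have "chain ?b y n *v w 0 = w (n mod k)" using Suc by simp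
        then have "chain ?b y (Suc n) *v w 0 = E (Suc n mod k) (n div k) *v (?x (\<sigma> n) *v w (n mod k))"
          by (simp only: chain.simps matrix_vector_mul_assoc[symmetric] y nat.case)
        also have "\<dots> = (if \<sigma> n = n then w (Suc n mod k) else 0)"
          using E lt eq by auto
        finally show ?thesis using True by (simp only: less_Suc_eq) auto
      next
        case False
        then have "chain ?b y n *v w 0 = 0" using Suc.IH Suc.prems by auto
        moreover have "\<not> (\<forall>i<Suc n. \<sigma> i = i)" using False by (meson less_SucI)
        ultimately show ?thesis
          by (simp only: chain.simps matrix_vector_mul_assoc[symmetric] if_False) simp
      qed
    qed
  qed
  have id: "(\<forall>i<N. \<sigma> i = i) \<longleftrightarrow> \<sigma> = id" if "\<sigma> permutes {..<N}" for \<sigma>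
    using permutes_not_in[OF that] by (auto simp: fun_eq_iff)
  have "capelli N ?b ?x *v w 0 =
      (\<Sum>p | p permutes {..<N}. if p = id then w (N mod k) else 0)"
    unfolding capelli_vector
  proof (rule sum.cong)
    fix p assume "p \<in> {p. p permutes {..<N}}"
    then have p: "p permutes {..<N}" by simp
    show "of_int (sign p) *s (chain ?b (?x \<circ> p) N *v w 0) = (if p = id then w (N mod k) else 0)"
      unfolding chain[OF p order_refl] id[OF p] by (simp add: sign_id)
  qed simp
  also have "\<dots> = w (N mod k)"
    by (simp add: finite_permutations permutes_id)
  finally show ?thesis .
qed

section \<open>The Capelli criterion for small submodules\<close>

lemma small_submodule_iff_capelli:
  fixes A :: "('a::field^'n^'n) set"
  assumes ac: "alg_closed_field TYPE('a)" and A: "mat_algebra A"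
  shows "(\<exists>W. vec.subspace W \<and> W \<noteq> {0} \<and> vec.dim W \<le> d \<and> invariant_under A W) \<longleftrightarrow>
    (\<exists>v. v \<noteq> 0 \<and> (\<forall>b x. range b \<subseteq> A \<longrightarrow> range x \<subseteq> A \<longrightarrow> capelli (d * d + 1) b x *v v = 0))"
proof
  assume "\<exists>W. vec.subspace W \<and> W \<noteq> {0} \<and> vec.dim W \<le> d \<and> invariant_under A W"
  then obtain W where W: "vec.subspace W" "W \<noteq> {0}" "vec.dim W \<le> d" "invariant_under A W" by auto
  then obtain v where v: "v \<in> W" "v \<noteq> 0" using vec.subspace_0 by fastforce
  have "capelli (d * d + 1) b x *v v = 0" if "range b \<subseteq> A" "range x \<subseteq> A" for b x
    by (rule capelli_small_submodule[OF W(1,4) _ _ v(1) W(3)]) (use that in auto)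
  then show "\<exists>v. v \<noteq> 0 \<and> (\<forall>b x. range b \<subseteq> A \<longrightarrow> range x \<subseteq> A \<longrightarrow> capelli (d * d + 1) b x *v v = 0)"
    using v by blast
next
  let ?N = "d * d + 1"
  assume "\<exists>v. v \<noteq> 0 \<and> (\<forall>b x. range b \<subseteq> A \<longrightarrow> range x \<subseteq> A \<longrightarrow> capelli ?N b x *v v = 0)"
  then obtain v where v: "v \<noteq> 0"
    "\<And>b x. range b \<subseteq> A \<Longrightarrow> range x \<subseteq> A \<Longrightarrow> capelli ?N b x *v v = 0" by blast
  \<comment> \<open>The common kernel \<open>U\<close> is a submodule, as a factor \<open>a\<close>
    on the right is absorbed into the separator \<open>b 0\<close>. A simple submodule of
    \<open>U\<close> has dimension at most \<open>d\<close>, since otherwise its matrix units give a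
    nonzero Capelli value.\<close>
  define U where "U = {v. \<forall>b x. range b \<subseteq> A \<longrightarrow> range x \<subseteq> A \<longrightarrow> capelli ?N b x *v v = 0}"
  have sU: "vec.subspace U"
    by (auto simp: vec.subspace_def U_def matrix_vector_right_distrib vector_scalar_commute)
  have U0: "U \<noteq> {0}" using v by (auto simp: U_def)
  have "capelli ?N b x *v (a *v u) = 0" if "a \<in> A" "u \<in> U" "range b \<subseteq> A" "range x \<subseteq> A" for a u b x
  proof -
    have "capelli ?N b x *v (a *v u) = capelli ?N (b(0 := b 0 ** a)) x *v u"
      unfolding capelli_vector by (simp only: matrix_vector_mul_assoc chain_mult_right)
    also have "\<dots> = 0"
      using that A by (auto simp: U_def mat_algebra_def image_subset_iff)
    finally show ?thesis .
  qed
  then have "invariant_under A U" by (auto simp: invariant_under_def U_def)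
  then obtain W where W: "simple_module A W" "W \<subseteq> U"
    using exists_simple_submodule[OF sU U0] by blast
  then have sW: "vec.subspace W" "W \<noteq> {0}" "invariant_under A W" by (auto simp: simple_module_def)
  have "vec.dim W \<le> d"
  proof (rule ccontr)
    define k where "k = vec.dim W"
    assume "\<not> vec.dim W \<le> d"
    then have dk: "d < k" by (simp add: k_def)
    have "d * d < k * k" using dk by (intro mult_strict_mono) auto
    then have Nk: "?N \<le> k * k" by simp
    obtain B where B: "B \<subseteq> W" "vec.independent B" "card B = k"
      using vec.basis_exists[of W] unfolding k_def by metis
    have "finite B" using B(2) by (rule vec.finiteI_independent)
    then obtain w where w: "bij_betw w {..<k} B"
      using B(3) ex_bij_betw_nat_finite[of B] by (auto simp: atLeast0LessThan)
    have wB: "w r \<in> B" if "r < k" for r using w that by (auto simp: bij_betw_def)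
    have "\<exists>a. p < k \<longrightarrow> q < k \<longrightarrow> a \<in> A \<and> (\<forall>r<k. a *v w r = (if q = r then w p else 0))" for p q
    proof (cases "p < k \<and> q < k")
      case True
      then obtain a where a: "a \<in> A" "a *v w q = w p" "\<forall>r\<in>B - {w q}. a *v r = 0"
        using simple_module_matrix_unit[OF ac W(1) A B(1,2), of "w p" "w q"] wB B(1) by blast
      have "a *v w r = 0" if "r < k" "q \<noteq> r" for r
        using a(3) wB[OF that(1)] w that True by (auto simp: bij_betw_def inj_on_def)
      then show ?thesis using a by (intro exI[of _ a]) auto
    qed auto
    then obtain E where E: "\<And>p q. p < k \<Longrightarrow> q < k \<Longrightarrow> E p q \<in> A"
      "\<And>p q r. p < k \<Longrightarrow> q < k \<Longrightarrow> r < k \<Longrightarrow> E p q *v w r = (if q = r then w p else 0)"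
      by metis
    \<comment> \<open>The polynomial uses \<open>b\<close> up to index \<open>?N\<close> and
      \<open>x\<close> below \<open>?N\<close>; the default \<open>mat 1\<close> keeps both
      sequences inside \<open>A\<close>.\<close>
    define b where "b i = (if i \<le> ?N then case i of 0 \<Rightarrow> E 0 0 | Suc j \<Rightarrow> E (Suc j mod k) (j div k) else mat 1)" for i
    define x where "x i = (if i < ?N then E (i div k) (i mod k) else mat 1)" for i
    have lt: "i div k < k" if "i < ?N" for i using that Nk dk by (auto simp: div_less_iff_less_mult)
    have ran: "range b \<subseteq> A" "range x \<subseteq> A"
      using A lt dk by (auto simp: b_def x_def mat_algebra_def intro!: E split: nat.split)
    have bx: "chain b (x \<circ> p) n = chain (\<lambda>i. case i of 0 \<Rightarrow> E 0 0 | Suc j \<Rightarrow> E (Suc j mod k) (j div k))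
        ((\<lambda>i. E (i div k) (i mod k)) \<circ> p) n" if "n \<le> ?N" "p permutes {..<?N}" for n p
      using that(1)
    proof (induction n)
      case (Suc n)
      then have "p n < ?N" using permutes_in_image[OF that(2), of n] by auto
      then have "x (p n) = E (p n div k) (p n mod k)" by (simp add: x_def)
      moreover have "b (Suc n) = E (Suc n mod k) (n div k)" using Suc.prems by (simp add: b_def)
      moreover note Suc.IH[OF Suc_leD[OF Suc.prems]]
      ultimately show ?case by (simp only: chain.simps o_apply nat.case)
    qed (simp add: b_def)
    have "capelli ?N b x *v w 0 = capelli ?N (\<lambda>i. case i of 0 \<Rightarrow> E 0 0 | Suc j \<Rightarrow> E (Suc j mod k) (j div k))
           (\<lambda>i. E (i div k) (i mod k)) *v w 0"
      unfolding capelli_vector by (rule sum.cong) (auto simp only: bx mem_Collect_eq order_refl)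
    also have "\<dots> = w (?N mod k)"
      by (rule capelli_matrix_units[OF E(2) _ Nk]) (use dk in auto)
    also have "\<dots> \<in> B" using dk by (intro wB) simp
    finally have "capelli ?N b x *v w 0 \<noteq> 0" using B(2) vec.dependent_zero by metis
    moreover have "w 0 \<in> U" using wB[of 0] dk B W(2) by auto
    ultimately show False using ran unfolding U_def by blast
  qed
  then show "\<exists>W. vec.subspace W \<and> W \<noteq> {0} \<and> vec.dim W \<le> d \<and> invariant_under A W"
    using sW by blast
qed

subsection \<open>Closed conditions\<close>

lemma polyfun_sum: "(\<And>i. i \<in> I \<Longrightarrow> f i \<in> polyfun) \<Longrightarrow> (\<lambda>x. \<Sum>i\<in>I. f i x) \<in> polyfun"
  by (induction I rule: infinite_finite_induct) (auto intro: polyfun.intros)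

lemma polyfun_prod: "(\<And>i. i \<in> I \<Longrightarrow> f i \<in> polyfun) \<Longrightarrow> (\<lambda>x. \<Prod>i\<in>I. f i x) \<in> polyfun"
  by (induction I rule: infinite_finite_induct) (auto intro: polyfun.intros)

lemma zariski_closed_Un:
  fixes Y Z :: "('v \<Rightarrow> 'a::field) set"
  assumes "zariski_closed Y" "zariski_closed Z"
  shows "zariski_closed (Y \<union> Z)"
proof -
  obtain F G where F: "F \<subseteq> polyfun" "Y = {x. \<forall>f\<in>F. f x = 0}"
    and G: "G \<subseteq> polyfun" "Z = {x. \<forall>f\<in>G. f x = 0}"
    using assms by (auto simp: zariski_closed_def)
  define H where "H = (\<lambda>(f, g) x. f x * g x) ` (F \<times> G)"
  have "(\<lambda>x. f x * g x) \<in> polyfun" if "f \<in> F" "g \<in> G" for f g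
    by (rule polyfun.mult) (use that F G in blast)+
  then have "H \<subseteq> polyfun" by (simp add: H_def image_subset_iff)
  moreover have "x \<in> Y \<union> Z \<longleftrightarrow> (\<forall>h\<in>H. h x = 0)" for x
  proof -
    have "(\<forall>h\<in>H. h x = 0) \<longleftrightarrow> (\<forall>f\<in>F. \<forall>g\<in>G. f x * g x = 0)"
      by (simp add: H_def)
    also have "\<dots> \<longleftrightarrow> x \<in> Y \<union> Z"
      unfolding F(2) G(2) mult_eq_0_iff Un_iff mem_Collect_eq by blast
    finally show ?thesis ..
  qed
  ultimately show ?thesis unfolding zariski_closed_def by (intro exI[of _ H]) auto
qed

lemma zariski_closed_UN:
  fixes Z :: "'i \<Rightarrow> ('v \<Rightarrow> 'a::field) set"
  assumes "finite I" "\<And>i. i \<in> I \<Longrightarrow> zariski_closed (Z i)"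
  shows "zariski_closed (\<Union>i\<in>I. Z i)"
  using assms
proof (induction I rule: finite_induct)
  case empty
  \<comment> \<open>The empty set is the zero set of the constant 1.\<close>
  show ?case unfolding zariski_closed_def
    by (rule exI[of _ "{\<lambda>_. 1}"]) (simp add: polyfun.const)
next
  case (insert i I)
  then show ?case by (simp add: zariski_closed_Un)
qed

section \<open>Matrices with polynomial entries\<close>

definition polymat :: "(('v \<Rightarrow> 'a::field) \<Rightarrow> 'a^'n^'n) \<Rightarrow> bool" where
  "polymat f \<longleftrightarrow> (\<forall>r c. (\<lambda>x. f x $ r $ c) \<in> polyfun)"

lemma polymat_const: "polymat (\<lambda>_. A)"
  by (simp add: polymat_def polyfun.const)

lemma polymat_add: "polymat f \<Longrightarrow> polymat g \<Longrightarrow> polymat (\<lambda>x. f x + g x)"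
  by (simp add: polymat_def polyfun.add)

lemma polymat_sum: "(\<And>i. i \<in> I \<Longrightarrow> polymat (f i)) \<Longrightarrow> polymat (\<lambda>x. \<Sum>i\<in>I. f i x)"
  by (auto simp: polymat_def intro!: polyfun_sum)

lemma polymat_mult: "polymat f \<Longrightarrow> polymat g \<Longrightarrow> polymat (\<lambda>x. f x ** g x)"
  by (auto simp: polymat_def matrix_matrix_mult_def intro!: polyfun_sum polyfun.mult)

lemma polymat_capelli:
  assumes "\<And>i. polymat (b i)" "\<And>i. polymat (y i)"
  shows "polymat (\<lambda>x. capelli N (\<lambda>i. b i x) (\<lambda>i. y i x))"
proof -
  have "polymat (\<lambda>x. chain (\<lambda>i. b i x) (\<lambda>i. y (p i) x) n)" for p n
    by (induction n) (simp_all add: assms polymat_mult)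
  then show ?thesis
    by (auto simp: capelli_def o_def intro!: polymat_sum polymat_mult polymat_const)
qed

text \<open>The vectors annihilated by all \<open>f x\<close> form a nonzero space iff all \<open>n \<times> n\<close> minors of the
  (possibly infinite) stack of the matrices \<open>f x\<close> vanish.\<close>
lemma zariski_closed_common_kernel:
  fixes S :: "(('v \<Rightarrow> 'a::field) \<Rightarrow> 'a^'n^'n) set"
  assumes S: "\<And>f. f \<in> S \<Longrightarrow> polymat f"
  shows "zariski_closed {x. \<exists>v. v \<noteq> 0 \<and> (\<forall>f\<in>S. f x *v v = 0)}"
proof -
  \<comment> \<open>Row \<open>i\<close> of \<open>?m f r x\<close> is row \<open>r i\<close> of
    \<open>f i x\<close>, so its determinant is a minor of the stack.\<close>
  let ?m = "\<lambda>f r x. (\<chi> i. f i x $ r i) :: 'a^'n^'n"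
  define F where "F = (\<lambda>(f, r) x. det (?m f r x)) ` ({f. \<forall>i. f i \<in> S} \<times> UNIV)"
  have "(\<lambda>x. det (?m f r x)) \<in> polyfun" if "\<forall>i. f i \<in> S" for f r
    unfolding det_def using S that
    by (auto simp: polymat_def intro!: polyfun_sum polyfun.mult polyfun.const polyfun_prod)
  then have "F \<subseteq> polyfun" by (simp add: F_def image_subset_iff)
  moreover have F: "(\<forall>h\<in>F. h x = 0) \<longleftrightarrow> (\<forall>f r. (\<forall>i. f i \<in> S) \<longrightarrow> det (?m f r x) = 0)" for x
    by (auto simp: F_def)
  moreover have "(\<exists>v. v \<noteq> 0 \<and> (\<forall>f\<in>S. f x *v v = 0)) \<longleftrightarrow> (\<forall>h\<in>F. h x = 0)" for x
  proof
    assume "\<exists>v. v \<noteq> 0 \<and> (\<forall>f\<in>S. f x *v v = 0)"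
    then obtain v where v: "v \<noteq> 0" "\<And>f. f \<in> S \<Longrightarrow> f x *v v = 0" by blast
    have "det (?m f r x) = 0" if "\<forall>i. f i \<in> S" for f r
    proof -
      have "?m f r x *v v = 0"
        using v(2) that by (simp add: vec_eq_iff matrix_vector_mult_def)
      then show ?thesis
        using v(1) invertible_det_nz[of "?m f r x"] matrix_left_invertible_ker[of "?m f r x"]
        unfolding invertible_def by blast
    qed
    then show "\<forall>h\<in>F. h x = 0" unfolding F by blast
  next
    assume h: "\<forall>h\<in>F. h x = 0"
    define R where "R = {f x $ r | f r. f \<in> S}"
    obtain B where B: "B \<subseteq> R" "vec.independent B" "R \<subseteq> vec.span B"
      by (rule vec.maximal_independent_subset)
    have fin: "finite B" using B(2) by (rule vec.finiteI_independent)
    obtain v where v: "v \<noteq> 0" "\<And>u. u \<in> B \<Longrightarrow> (\<Sum>j\<in>UNIV. u $ j * v $ j) = 0"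
    proof (cases "B = {}")
      case True
      \<comment> \<open>All rows are zero or there are none: the all-ones vector will do.\<close>
      then show thesis using that[of 1] by (simp add: vec_eq_iff)
    next
      case False
      have "card B \<le> CARD('n)"
        using vec.independent_card_le_dim[OF subset_UNIV B(2)] by (simp only: vec_dim_card)
      then obtain k :: "'a^'n \<Rightarrow> 'n" where k: "inj_on k B"
        using card_le_inj[OF fin, of "UNIV :: 'n set"] by auto
      obtain u0 where "u0 \<in> B" using False by auto
      \<comment> \<open>The basis of the row space is spread over distinct rows of a square matrix,
        and the free rows repeat \<open>u0\<close>. A kernel vector of this singular matrix is
        orthogonal to the whole basis.\<close>
      define g where "g i = (if i \<in> k ` B then inv_into B k i else u0)" for i
      have gB: "g i \<in> B" for i using \<open>u0 \<in> B\<close> by (auto simp: g_def inv_into_into)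
      have gk: "g (k u) = u" if "u \<in> B" for u using k that by (simp add: g_def)
      have "\<forall>i. \<exists>f r. f \<in> S \<and> g i = f x $ r" using gB B(1) unfolding R_def by blast
      then obtain f r where fr: "\<And>i. f i \<in> S" "\<And>i. g i = f i x $ r i" by metis
      have "det (?m f r x) = 0" using h fr(1) unfolding F by blast
      then have "\<not> (\<exists>A'. A' ** ?m f r x = mat 1)"
        using invertible_det_nz[of "?m f r x"] invertible_left_inverse[of "?m f r x"] by auto
      then obtain v where v: "v \<noteq> 0" "?m f r x *v v = 0"
        using matrix_left_invertible_ker[of "?m f r x"] by auto
      have "(\<Sum>j\<in>UNIV. g i $ j * v $ j) = 0" for i
        using v(2) by (auto simp: vec_eq_iff matrix_vector_mult_def fr(2))
      then show thesis using that[OF v(1)] gk by metis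
    qed
    have "vec.subspace {u. (\<Sum>j\<in>UNIV. u $ j * v $ j) = 0}"
      by (auto simp: vec.subspace_def sum.distrib algebra_simps sum_distrib_left[symmetric])
    then have "vec.span B \<subseteq> {u. (\<Sum>j\<in>UNIV. u $ j * v $ j) = 0}"
      using v(2) by (intro vec.span_minimal) auto
    then have "(\<Sum>j\<in>UNIV. f x $ r $ j * v $ j) = 0" if "f \<in> S" for f r
      using B(3) that unfolding R_def by blast
    then have "f x *v v = 0" if "f \<in> S" for f
      using that by (simp add: vec_eq_iff matrix_vector_mult_def)
    then show "\<exists>v. v \<noteq> 0 \<and> (\<forall>f\<in>S. f x *v v = 0)" using v(1) by blast
  qed
  ultimately show ?thesis unfolding zariski_closed_def by (intro exI[of _ F]) simp
qed

text \<open>The members are matrix-valued functions of the point \<open>x\<close>, not matrices: one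
  fixed family of polynomial functions yields the generated algebra at every point.\<close>

inductive_set alg_gen :: "('x \<Rightarrow> 'a::field^'n^'n) set \<Rightarrow> ('x \<Rightarrow> 'a^'n^'n) set" for S where
  gen: "f \<in> S \<Longrightarrow> f \<in> alg_gen S"
| const: "(\<lambda>_. mat c) \<in> alg_gen S"
| add: "f \<in> alg_gen S \<Longrightarrow> g \<in> alg_gen S \<Longrightarrow> (\<lambda>x. f x + g x) \<in> alg_gen S"
| mult: "f \<in> alg_gen S \<Longrightarrow> g \<in> alg_gen S \<Longrightarrow> (\<lambda>x. f x ** g x) \<in> alg_gen S"

lemma polymat_alg_gen:
  assumes "f \<in> alg_gen S" "\<And>f. f \<in> S \<Longrightarrow> polymat f" shows "polymat f"
  using assms by induction (auto intro: polymat_const polymat_add polymat_mult)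

lemma mat_algebra_alg_gen: "mat_algebra ((\<lambda>f. f x) ` alg_gen S)"
proof -
  have "mat c \<in> (\<lambda>f. f x) ` alg_gen S" for c
    by (rule image_eqI[OF _ alg_gen.const]) simp
  moreover have "f x + g x \<in> (\<lambda>f. f x) ` alg_gen S" if "f \<in> alg_gen S" "g \<in> alg_gen S" for f g
    by (rule image_eqI[OF _ alg_gen.add[OF that]]) simp
  moreover have "f x ** g x \<in> (\<lambda>f. f x) ` alg_gen S" if "f \<in> alg_gen S" "g \<in> alg_gen S" for f g
    by (rule image_eqI[OF _ alg_gen.mult[OF that]]) simp
  ultimately show ?thesis by (auto simp: mat_algebra_def)
qed

lemma invariant_under_alg_gen:
  assumes W: "vec.subspace W"
  shows "invariant_under ((\<lambda>f. f x) ` alg_gen S) W \<longleftrightarrow> invariant_under ((\<lambda>f. f x) ` S) W"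
proof
  assume inv: "invariant_under ((\<lambda>f. f x) ` S) W"
  have "f x *v v \<in> W" if "f \<in> alg_gen S" "v \<in> W" for f v
    using that
    by (induction arbitrary: v)
      (use inv W in \<open>auto simp: invariant_under_def matrix_vector_mult_add_rdistrib vec.subspace_add
        vec.subspace_scale matrix_vector_mul_assoc[symmetric]\<close>)
  then show "invariant_under ((\<lambda>f. f x) ` alg_gen S) W" by (auto simp: invariant_under_def)
qed (auto simp: invariant_under_def intro: alg_gen.gen)

text \<open>The set \<open>C\<close> of Capelli expressions over the generated functions does not
  depend on the point, so the Capelli criterion turns into a common kernel condition on polynomial
  matrices.\<close>

lemma zariski_closed_small_invariant_subspace:
  fixes S :: "(('v \<Rightarrow> 'a::field) \<Rightarrow> 'a^'n^'n) set"
  assumes ac: "alg_closed_field TYPE('a)" and S: "\<And>f. f \<in> S \<Longrightarrow> polymat f"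
  shows "zariski_closed {x. \<exists>W. vec.subspace W \<and> W \<noteq> {0} \<and> vec.dim W \<le> d \<and>
           invariant_under ((\<lambda>f. f x) ` S) W}"
proof -
  let ?A = "alg_gen S" and ?N = "d * d + 1"
  define C where "C = (\<lambda>(b, y) x. capelli ?N (\<lambda>i. b i x) (\<lambda>i. y i x)) `
    ({b. range b \<subseteq> ?A} \<times> {y. range y \<subseteq> ?A})"
  have C: "(\<forall>f\<in>C. P f) \<longleftrightarrow> (\<forall>b y. range b \<subseteq> ?A \<longrightarrow> range y \<subseteq> ?A \<longrightarrow>
      P (\<lambda>x. capelli ?N (\<lambda>i. b i x) (\<lambda>i. y i x)))" for P
    by (auto simp: C_def)
  have pA: "polymat f" if "f \<in> ?A" for f
    using polymat_alg_gen[OF that S] .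
  have "\<forall>f\<in>C. polymat f"
    unfolding C by (intro allI impI polymat_capelli pA) auto
  then have "zariski_closed {x. \<exists>v. v \<noteq> 0 \<and> (\<forall>f\<in>C. f x *v v = 0)}"
    by (intro zariski_closed_common_kernel) simp
  moreover have "(\<exists>W. vec.subspace W \<and> W \<noteq> {0} \<and> vec.dim W \<le> d \<and> invariant_under ((\<lambda>f. f x) ` S) W) \<longleftrightarrow>
      (\<exists>v. v \<noteq> 0 \<and> (\<forall>f\<in>C. f x *v v = 0))" for x
  proof -
    let ?Ax = "(\<lambda>f. f x) ` ?A"
    \<comment> \<open>Any sequence in the algebra at \<open>x\<close> is the value at
      \<open>x\<close> of a sequence of functions.\<close>
    have lift: "\<exists>b'. range b' \<subseteq> ?A \<and> b = (\<lambda>i. b' i x)" if "range b \<subseteq> ?Ax" for b :: "nat \<Rightarrow> 'a^'n^'n"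
    proof -
      have "b i \<in> ?Ax" for i using that by (rule subsetD) simp
      then have "\<forall>i. \<exists>f. f \<in> ?A \<and> b i = f x" by (auto elim!: imageE)
      then obtain b' where "\<forall>i. b' i \<in> ?A \<and> b i = b' i x" by metis
      then show ?thesis by (intro exI[of _ b']) auto
    qed
    have key: "(\<forall>b y. range b \<subseteq> ?Ax \<longrightarrow> range y \<subseteq> ?Ax \<longrightarrow> capelli ?N b y *v v = 0) \<longleftrightarrow>
        (\<forall>f\<in>C. f x *v v = 0)" for v
    proof
      assume l: "\<forall>b y. range b \<subseteq> ?Ax \<longrightarrow> range y \<subseteq> ?Ax \<longrightarrow> capelli ?N b y *v v = 0"
      have "capelli ?N (\<lambda>i. b i x) (\<lambda>i. y i x) *v v = 0" if "range b \<subseteq> ?A" "range y \<subseteq> ?A" for b y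
        using that by (intro l[rule_format]) (simp_all add: image_subset_iff)
      then show "\<forall>f\<in>C. f x *v v = 0" unfolding C by blast
    next
      assume r: "\<forall>f\<in>C. f x *v v = 0"
      show "\<forall>b y. range b \<subseteq> ?Ax \<longrightarrow> range y \<subseteq> ?Ax \<longrightarrow> capelli ?N b y *v v = 0"
      proof (intro allI impI)
        fix b y :: "nat \<Rightarrow> 'a^'n^'n"
        assume "range b \<subseteq> ?Ax" "range y \<subseteq> ?Ax"
        then obtain b' y' where *: "range b' \<subseteq> ?A" "b = (\<lambda>i. b' i x)" "range y' \<subseteq> ?A" "y = (\<lambda>i. y' i x)"
          using lift[of b] lift[of y] by metis
        show "capelli ?N b y *v v = 0"
          using r[unfolded C, rule_format, OF *(1,3)] by (simp only: *(2,4))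
      qed
    qed
    have "(\<exists>W. vec.subspace W \<and> W \<noteq> {0} \<and> vec.dim W \<le> d \<and> invariant_under ((\<lambda>f. f x) ` S) W) \<longleftrightarrow>
        (\<exists>W. vec.subspace W \<and> W \<noteq> {0} \<and> vec.dim W \<le> d \<and> invariant_under ?Ax W)"
      by (intro ex_cong1 conj_cong refl) (simp add: invariant_under_alg_gen)
    also have "\<dots> \<longleftrightarrow> (\<exists>v. v \<noteq> 0 \<and> (\<forall>f\<in>C. f x *v v = 0))"
      unfolding small_submodule_iff_capelli[OF ac mat_algebra_alg_gen] key ..
    finally show ?thesis .
  qed
  ultimately show ?thesis by simp
qed

subsection \<open>Systems of imprimitivity\<close>

text \<open>Words contain no inverses, so their entries are polynomials in the entries of the
  generators.\<close>

primrec word_mat :: "('e \<Rightarrow> 'a::field^'n^'n) \<Rightarrow> 'e list \<Rightarrow> 'a^'n^'n" where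
  "word_mat g [] = mat 1"
| "word_mat g (i # w) = g i ** word_mat g w"

lemma word_mat_append: "word_mat g (u @ w) = word_mat g u ** word_mat g w"
  by (induction u) (simp_all add: matrix_mul_assoc)

lemma invertible_word_mat: "(\<And>i. invertible (g i)) \<Longrightarrow> invertible (word_mat g w)"
  by (induction w) (auto simp: invertible_mult invertible_def[of "mat 1"] intro: exI[of _ "mat 1"])

abbreviation mimage :: "'a::field^'n^'n \<Rightarrow> ('a^'n) set \<Rightarrow> ('a^'n) set" where
  "mimage h W \<equiv> (\<lambda>v. h *v v) ` W"

lemma mimage_mult: "mimage (a ** b) W = mimage a (mimage b W)"
  by (auto simp: image_image matrix_vector_mul_assoc)

lemma subspace_mimage: "vec.subspace W \<Longrightarrow> vec.subspace (mimage (h :: 'a::field^'n^'n) W)"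
  by (rule vec.subspace_image)

lemma inj_invertible: "invertible (h :: 'a::field^'n^'n) \<Longrightarrow> inj (\<lambda>v. h *v v)"
  by (simp add: inj_matrix_vector_mult)

lemma dim_mimage: "invertible (h :: 'a::field^'n^'n) \<Longrightarrow> vec.dim (mimage h W) = vec.dim W"
  by (rule vec.dim_image_eq[OF _ inj_on_subset[OF inj_invertible]]) auto

text \<open>Equal finite dimensions force equality. This is how inverses of the generators are
  handled.\<close>

lemma mimage_eq_of_subset:
  assumes "invertible (h :: 'a::field^'n^'n)" "vec.subspace W" "mimage h W \<subseteq> W"
  shows "mimage h W = W"
  using assms by (intro vec.subspace_dim_equal subspace_mimage) (simp_all add: dim_mimage)

lemma mimage_matrix_inv:
  assumes "invertible h" shows "mimage (matrix_inv h) (mimage h W) = W"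
proof -
  have "matrix_inv h ** h = mat 1"
    unfolding matrix_inv_def using assms unfolding invertible_def by (metis (mono_tags, lifting) someI_ex)
  then show ?thesis by (simp add: image_image matrix_vector_mul_assoc)
qed

lemma invariant_gen_group:
  assumes g: "\<And>i. invertible (g i)" and W: "vec.subspace W" and inv: "invariant_under (range g) W"
  shows "invariant_under (gen_group (range g)) W"
proof -
  have "h *v v \<in> W" if "h \<in> gen_group (range g)" "v \<in> W" for h v
    using that
  proof (induction arbitrary: v)
    case (inv h)
    then have h: "invertible h" "mimage h W = W"
      using g mimage_eq_of_subset[of h W] W \<open>invariant_under (range g) W\<close>
      by (auto simp: invariant_under_def)
    then have "mimage (matrix_inv h) W = W" using mimage_matrix_inv[of h W] by simp
    then show ?case using inv by blast
  qed (use inv in \<open>auto simp: invariant_under_def matrix_vector_mul_assoc[symmetric]\<close>)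
  then show ?thesis by (simp add: invariant_under_def)
qed

lemma acts_irreducibly_gen_group:
  assumes g: "\<And>i. invertible (g i)"
  shows "acts_irreducibly (gen_group (range g)) \<longleftrightarrow>
    (\<forall>W. vec.subspace W \<longrightarrow> invariant_under (range g) W \<longrightarrow> W = {0} \<or> W = UNIV)"
proof -
  have "invariant_under (gen_group (range g)) W \<longleftrightarrow> invariant_under (range g) W"
    if "vec.subspace W" for W
    using invariant_gen_group[where g = g, OF g that] gen_group.gen[of _ "range g"]
    unfolding invariant_under_def by blast
  then show ?thesis
    unfolding acts_irreducibly_def invariant_under_def[symmetric] by blast
qed

lemma invariant_word_mat:
  "invariant_under (range (word_mat g)) W \<longleftrightarrow> invariant_under (range g) W"
proof
  assume inv: "invariant_under (range g) W"
  have "word_mat g w *v v \<in> W" if "v \<in> W" for w v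
    using that inv by (induction w) (auto simp: invariant_under_def matrix_vector_mul_assoc[symmetric])
  then show "invariant_under (range (word_mat g)) W" by (auto simp: invariant_under_def)
next
  assume inv: "invariant_under (range (word_mat g)) W"
  have "g i = word_mat g [i]" for i by simp
  then show "invariant_under (range g) W" using inv unfolding invariant_under_def by (metis rangeE rangeI)
qed

text \<open>For a subspace the bound \<open>CARD('n) - 1\<close> means being proper. Using all words
  instead of the generators gives the condition the same shape as the one for loops.\<close>

lemma reducible_iff_small_invariant:
  fixes g :: "'e \<Rightarrow> 'a::field^'n^'n"
  assumes g: "\<And>i. invertible (g i)"
  shows "\<not> acts_irreducibly (gen_group (range g)) \<longleftrightarrow>
    (\<exists>W. vec.subspace W \<and> W \<noteq> {0} \<and> vec.dim W \<le> CARD('n) - 1 \<and> invariant_under (range (word_mat g)) W)"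
proof -
  have "vec.dim W \<le> CARD('n) - 1 \<longleftrightarrow> W \<noteq> UNIV" if "vec.subspace W" for W :: "('a^'n) set"
  proof
    assume "vec.dim W \<le> CARD('n) - 1"
    then have "vec.dim W < CARD('n)" using zero_less_card_finite[where 'a = 'n] by linarith
    then show "W \<noteq> UNIV" by (metis vec_dim_card nat_less_le)
  next
    assume "W \<noteq> UNIV"
    then have "vec.dim W \<noteq> CARD('n)"
      using that vec.subspace_dim_equal[of W UNIV] by (auto simp: vec_dim_card simp del: vec.dim_UNIV)
    moreover have "vec.dim W \<le> CARD('n)" using vec.dim_subset[of W UNIV] by (simp only: vec_dim_card subset_UNIV simp_thms)
    ultimately show "vec.dim W \<le> CARD('n) - 1" by linarith
  qed
  then show ?thesis
    unfolding acts_irreducibly_gen_group[where g = g, OF g] invariant_word_mat by blast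
qed

lemma span_Union_invariant:
  assumes "\<And>i X. X \<in> D \<Longrightarrow> mimage (g i) X \<in> D"
  shows "invariant_under (range g) (vec.span (\<Union>D))"
proof -
  have "mimage (g i) (vec.span (\<Union>D)) \<subseteq> vec.span (\<Union>D)" for i
    unfolding vec.span_image[symmetric] using assms by (intro vec.span_mono) blast
  then show ?thesis by (auto simp: invariant_under_def)
qed

lemma irreducible_span_Union:
  assumes irr: "acts_irreducibly (gen_group (range g))" and g: "\<And>i. invertible (g i)"
    and "\<And>i X. X \<in> D \<Longrightarrow> mimage (g i) X \<in> D" and X: "X \<in> D" "X \<noteq> {0}" "X \<noteq> {}"
  shows "vec.span (\<Union>D) = UNIV"
proof -
  have "vec.span (\<Union>D) = {0} \<or> vec.span (\<Union>D) = UNIV"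
    using irr[unfolded acts_irreducibly_gen_group[where g = g, OF g], rule_format,
        OF vec.subspace_span span_Union_invariant[of D g, OF assms(3)]] .
  moreover have "X \<subseteq> vec.span (\<Union>D)" using vec.span_superset[of "\<Union>D"] X(1) by (meson Union_upper subset_trans)
  ultimately show ?thesis using X by (metis subset_singletonD)
qed

section \<open>Dimensions of sums of subspaces\<close>

lemma dim_Un_Int: "vec.dim (A \<union> B) + vec.dim (vec.span A \<inter> vec.span B) = vec.dim A + vec.dim (B :: ('a::field^'n) set)"
proof -
  have "vec.dim (A \<union> B) = vec.dim {x + y |x y. x \<in> vec.span A \<and> y \<in> vec.span B}"
    unfolding vec.dim_span[of "A \<union> B", symmetric] vec.span_Un ..
  then show ?thesis
    using vec.dim_sums_Int[OF vec.subspace_span vec.subspace_span, of A B]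
    by (simp only: vec.dim_span)
qed

lemma dim_Union_le:
  "finite D \<Longrightarrow> vec.dim (\<Union>D) \<le> (\<Sum>X\<in>D. vec.dim (X :: ('a::field^'n) set))"
proof (induction D rule: finite_induct)
  case (insert X D)
  then show ?case using dim_Un_Int[of X "\<Union>D"] by simp
qed simp

text \<open>The blocks are added one at a time; each meets the span of the previous ones only in
  zero, so the dimension formula for sums is additive at every step.\<close>

lemma dim_Union_direct:
  fixes D :: "('a::field^'n) set set"
  assumes "finite D" "\<And>X. X \<in> D \<Longrightarrow> vec.subspace X"
    and "\<And>X. X \<in> D \<Longrightarrow> X \<inter> vec.span (\<Union>(D - {X})) = {0}"
  shows "vec.dim (\<Union>D) = (\<Sum>X\<in>D. vec.dim X)"
proof -
  have "vec.dim (\<Union>F) = (\<Sum>X\<in>F. vec.dim X)" if "finite F" "F \<subseteq> D" for F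
    using that
  proof (induction F rule: finite_induct)
    case (insert X F)
    then have "\<Union>F \<subseteq> \<Union>(D - {X})" by blast
    then have "vec.span (\<Union>F) \<subseteq> vec.span (\<Union>(D - {X}))" by (rule vec.span_mono)
    moreover have "vec.span X = X" using insert.prems assms(2) by (simp add: vec.span_eq_iff)
    moreover have "X \<inter> vec.span (\<Union>(D - {X})) = {0}" using assms(3) insert.prems by simp
    ultimately have "vec.span X \<inter> vec.span (\<Union>F) \<subseteq> {0}" by blast
    then have "vec.dim (vec.span X \<inter> vec.span (\<Union>F)) = 0" by (simp only: vec.dim_eq_0)
    then have "vec.dim (X \<union> \<Union>F) = vec.dim X + vec.dim (\<Union>F)"
      using dim_Un_Int[of X "\<Union>F"] by linarith
    then show ?case using insert by simp
  qed simp
  then show ?thesis using assms(1) by blast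
qed

section \<open>Words acting on labels of blocks\<close>

definition reach :: "('e \<Rightarrow> 's \<Rightarrow> 's) \<Rightarrow> 's \<Rightarrow> 's set" where
  "reach \<phi> s = range (\<lambda>w. foldr \<phi> w s)"

text \<open>This stands in for transitivity of a permutation action: the maps
  \<open>\<phi> i\<close> need not be bijective, but every label reached from \<open>s\<close> has a
  word leading back.\<close>

definition strongly_connected :: "('e \<Rightarrow> 's \<Rightarrow> 's) \<Rightarrow> 's \<Rightarrow> bool" where
  "strongly_connected \<phi> s \<longleftrightarrow> (\<forall>j\<in>reach \<phi> s. s \<in> reach \<phi> j)"

definition loops :: "('e \<Rightarrow> 's \<Rightarrow> 's) \<Rightarrow> 's \<Rightarrow> 'e list set" where
  "loops \<phi> s = {w. foldr \<phi> w s = s}"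

text \<open>The translate of \<open>W\<close> under a word depends only on the label to which the
  word takes \<open>s\<close>, so there are at most \<open>card (reach \<phi> s)\<close> translates.
  They span by irreducibility, and the dimension bound leaves no room for coincidences or
  overlaps.\<close>

lemma imprimitivity_system_from_loops:
  fixes g :: "'e \<Rightarrow> 'a::field^'n^'n" and \<phi> :: "'e \<Rightarrow> 's \<Rightarrow> 's"
  assumes g: "\<And>i. invertible (g i)" and irr: "acts_irreducibly (gen_group (range g))"
    and sc: "strongly_connected \<phi> s" and t: "1 < card (reach \<phi> s)"
    and W: "vec.subspace W" "W \<noteq> {0}" "card (reach \<phi> s) * vec.dim W \<le> CARD('n)"
    and inv: "invariant_under (word_mat g ` loops \<phi> s) W"
  shows "\<exists>D. imprimitivity_system (gen_group (range g)) D"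
proof -
  let ?R = "reach \<phi> s" and ?m = "vec.dim W"
  have finR: "finite ?R" using t by (metis card.infinite not_one_less_zero)
  have invw: "invertible (word_mat g w)" for w by (rule invertible_word_mat[OF g])
  define wd where "wd j = (SOME w. foldr \<phi> w s = j)" for j
  have wd: "foldr \<phi> (wd j) s = j" if "j \<in> ?R" for j
  proof -
    have "\<exists>w. foldr \<phi> w s = j" using that by (auto simp: reach_def)
    then show ?thesis unfolding wd_def by (rule someI_ex)
  qed
  define V where "V j = mimage (word_mat g (wd j)) W" for j
  have loop: "mimage (word_mat g w) W = W" if "foldr \<phi> w s = s" for w
    using that inv by (intro mimage_eq_of_subset invw W) (auto simp: invariant_under_def loops_def)
  \<comment> \<open>A word \<open>u\<close> leading back to \<open>s\<close> completes both
    \<open>w\<close> and \<open>wd ?j\<close> to loops, which fix \<open>W\<close>; cancelling the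
    invertible matrix of \<open>u\<close> identifies the two translates.\<close>
  have V: "mimage (word_mat g w) W = V (foldr \<phi> w s)" for w
  proof -
    let ?j = "foldr \<phi> w s"
    have j: "?j \<in> ?R" by (auto simp: reach_def)
    then have "s \<in> reach \<phi> ?j" using sc by (simp only: strongly_connected_def)
    then obtain u where u: "foldr \<phi> u ?j = s" unfolding reach_def by (metis rangeE)
    have "mimage (word_mat g u) (mimage (word_mat g w) W) = W"
      using loop[of "u @ w"] u by (simp only: word_mat_append mimage_mult foldr_append o_apply)
    also have "W = mimage (word_mat g u) (V ?j)"
      using loop[of "u @ wd ?j"] u wd[OF j]
      by (simp only: V_def word_mat_append mimage_mult foldr_append o_apply)
    finally show ?thesis by (simp only: inj_image_eq_iff[OF inj_invertible[OF invw]])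
  qed
  have gV: "mimage (g i) (V j) = V (\<phi> i j)" and reachg: "\<phi> i j \<in> ?R" if "j \<in> ?R" for i j
  proof -
    show "mimage (g i) (V j) = V (\<phi> i j)"
      using V[of "i # wd j"] wd[OF that] by (simp only: word_mat.simps mimage_mult V_def[of j] foldr.simps o_apply)
    have "\<phi> i j = foldr \<phi> (i # wd j) s" using wd[OF that] by simp
    then show "\<phi> i j \<in> ?R" unfolding reach_def by blast
  qed
  define D where "D = V ` ?R"
  have D: "vec.subspace X" "vec.dim X = ?m" if "X \<in> D" for X
    using that W by (auto simp: D_def V_def dim_mimage[OF invw] subspace_mimage)
  have m0: "0 < ?m" using W(1,2) vec.dim_eq_0[of W] vec.subspace_0[OF W(1)] by auto
  have D0: "X \<noteq> {0}" if "X \<in> D" for X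
  proof
    assume "X = {0}"
    then have "vec.dim X = 0" by simp
    then show False using D(2)[OF that] m0 by linarith
  qed
  have finD: "finite D" using finR by (simp add: D_def)
  have gD: "mimage (g i) X \<in> D" if "X \<in> D" for i X
    using that gV reachg by (auto simp: D_def)
  have "s \<in> ?R" unfolding reach_def by (rule range_eqI[of _ _ "[]"]) simp
  then have "V s \<in> D" by (simp add: D_def)
  moreover have "V s \<noteq> {}" using vec.subspace_0[OF D(1)[OF calculation]] by auto
  ultimately have span: "vec.span (\<Union>D) = UNIV"
    using irreducible_span_Union[where g = g and X = "V s" and D = D, OF irr g gD] D0 by simp
  have "vec.dim (\<Union>D) = vec.dim (vec.span (\<Union>D))" by (simp only: vec.dim_span)
  then have dimD: "vec.dim (\<Union>D) = CARD('n)" by (simp only: span vec_dim_card)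
  \<comment> \<open>With the upper bound on \<open>card ?R * ?m\<close>, this shows that distinct
    labels have distinct translates.\<close>
  have "CARD('n) \<le> card D * ?m" using dim_Union_le[OF finD] dimD D(2) by simp
  with W(3) have "card ?R * ?m \<le> card D * ?m" by (rule le_trans)
  then have "card ?R \<le> card D" using m0 mult_le_cancel2 by blast
  moreover have "card D \<le> card ?R" unfolding D_def by (rule card_image_le[OF finR])
  ultimately have cD: "card D = card ?R" by simp
  have direct: "X \<inter> vec.span (\<Union>(D - {X})) = {0}" if X: "X \<in> D" for X
  proof -
    have le: "vec.dim (\<Union>(D - {X})) \<le> (card ?R - 1) * ?m"
      using dim_Union_le[of "D - {X}"] finD D(2) X cD by simp
    have eq: "X \<union> \<Union>(D - {X}) = \<Union>D" using X by auto
    have sp: "vec.span X = X" using D(1)[OF X] by (simp only: vec.span_eq_iff)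
    have "CARD('n) + vec.dim (X \<inter> vec.span (\<Union>(D - {X}))) = ?m + vec.dim (\<Union>(D - {X}))"
      using dim_Un_Int[of X "\<Union>(D - {X})"] by (simp only: eq sp dimD D(2)[OF X])
    moreover have "?m + (card ?R - 1) * ?m = card ?R * ?m" using t by (cases "card ?R") auto
    ultimately have "vec.dim (X \<inter> vec.span (\<Union>(D - {X}))) = 0" using W(3) le by linarith
    then have "X \<inter> vec.span (\<Union>(D - {X})) \<subseteq> {0}" by (simp only: vec.dim_eq_0)
    moreover have "0 \<in> X \<inter> vec.span (\<Union>(D - {X}))"
      using vec.subspace_0[OF D(1)[OF X]] vec.span_zero by (rule IntI)
    ultimately show ?thesis by blast
  qed
  have "mimage h X \<in> D" if "h \<in> gen_group (range g)" "X \<in> D" for h X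
    using that
  proof (induction arbitrary: X)
    case (inv h)
    then obtain i where h: "h = g i" by auto
    have hi: "invertible h" using g h by simp
    \<comment> \<open>A generator permutes the finite set \<open>D\<close>, hence so does its
      inverse.\<close>
    have "inj_on (mimage h) D"
      by (rule inj_onI) (simp only: inj_image_eq_iff[OF inj_invertible[OF hi]])
    moreover have "mimage h ` D \<subseteq> D" using gD h by auto
    ultimately have "mimage h ` D = D" using finD by (intro endo_inj_surj)
    then have "X \<in> mimage h ` D" using inv.prems by (simp only:)
    then obtain Y where "Y \<in> D" "X = mimage h Y" by (rule imageE)
    then show ?case using mimage_matrix_inv[of h Y] g h by simp
  qed (auto simp: gD mimage_mult)
  then have "imprimitivity_system (gen_group (range g)) D"
    unfolding imprimitivity_system_def using finD cD t D(1) D0 span direct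
    by (intro conjI ballI) simp_all
  then show ?thesis ..
qed

text \<open>\<open>W\<close> is one of the blocks, and \<open>\<phi>\<close> is the action of the
  generators on the blocks, carried over to labels in \<open>'n\<close>. Labels from a fixed finite
  type leave only finitely many actions when \<open>'e\<close> is finite.\<close>

lemma loops_from_imprimitivity_system:
  fixes g :: "'e \<Rightarrow> 'a::field^'n^'n"
  assumes g: "\<And>i. invertible (g i)" and irr: "acts_irreducibly (gen_group (range g))"
    and D: "imprimitivity_system (gen_group (range g)) D"
  shows "\<exists>(\<phi> :: 'e \<Rightarrow> 'n \<Rightarrow> 'n) s W. strongly_connected \<phi> s \<and> 1 < card (reach \<phi> s) \<and>
    vec.subspace W \<and> W \<noteq> {0} \<and> card (reach \<phi> s) * vec.dim W \<le> CARD('n) \<and>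
    invariant_under (word_mat g ` loops \<phi> s) W"
proof -
  have finD: "finite D" and cD: "1 < card D" and DD: "\<And>X. X \<in> D \<Longrightarrow> vec.subspace X \<and> X \<noteq> {0}"
    and span: "vec.span (\<Union>D) = UNIV" and direct: "\<And>X. X \<in> D \<Longrightarrow> X \<inter> vec.span (\<Union>(D - {X})) = {0}"
    and gD: "\<And>i X. X \<in> D \<Longrightarrow> mimage (g i) X \<in> D"
    using D gen_group.gen[of _ "range g"] by (auto simp: imprimitivity_system_def)
  have wD: "mimage (word_mat g w) X \<in> D" if "X \<in> D" for w X
    by (induction w) (auto simp: that mimage_mult gD)
  have trans: "(\<lambda>w. mimage (word_mat g w) X) ` UNIV = D" if X: "X \<in> D" for X
  proof
    show "range (\<lambda>w. mimage (word_mat g w) X) \<subseteq> D" using wD[OF X] by auto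
    let ?O = "range (\<lambda>w. mimage (word_mat g w) X)"
    have "X \<in> ?O" by (rule range_eqI[of _ _ "[]"]) simp
    moreover have "mimage (g i) Y \<in> ?O" if "Y \<in> ?O" for i Y
    proof -
      from that obtain w where "Y = mimage (word_mat g w) X" by auto
      then have "mimage (g i) Y = mimage (word_mat g (i # w)) X" by (simp add: mimage_mult)
      then show ?thesis by blast
    qed
    moreover have "X \<noteq> {0}" "X \<noteq> {}" using DD[OF X] vec.subspace_0 by auto
    ultimately have O: "vec.span (\<Union>?O) = UNIV"
      using irreducible_span_Union[where g = g and X = X and D = ?O, OF irr g] by blast
    \<comment> \<open>The orbit of a block spans the whole space, whereas a block outside the orbit
      would meet that span only in zero.\<close>
    show "D \<subseteq> ?O"
    proof
      fix Y assume Y: "Y \<in> D"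
      show "Y \<in> ?O"
      proof (rule ccontr)
        assume "Y \<notin> ?O"
        then have "?O \<subseteq> D - {Y}" using wD[OF X] by auto
        then have "vec.span (\<Union>?O) \<subseteq> vec.span (\<Union>(D - {Y}))"
          by (intro vec.span_mono Union_mono)
        then have "vec.span (\<Union>(D - {Y})) = UNIV" by (simp only: O top_unique)
        then show False using direct[OF Y] DD[OF Y] by simp
      qed
    qed
  qed
  obtain X0 where X0: "X0 \<in> D" using cD by fastforce
  have dimX: "vec.dim X = vec.dim X0" if "X \<in> D" for X
  proof -
    from that obtain w where "X = mimage (word_mat g w) X0" using trans[OF X0] by auto
    then show ?thesis using dim_mimage[OF invertible_word_mat[of g, OF g]] by simp
  qed
  have "CARD('n) = vec.dim (vec.span (\<Union>D))" by (simp only: span vec_dim_card)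
  also have "\<dots> = vec.dim (\<Union>D)" by (simp only: vec.dim_span)
  also have "\<dots> = (\<Sum>X\<in>D. vec.dim X)" by (rule dim_Union_direct[OF finD]) (use DD direct in auto)
  also have "\<dots> = card D * vec.dim X0" by (simp add: dimX)
  finally have dim: "CARD('n) = card D * vec.dim X0" .
  \<comment> \<open>All blocks have the same positive dimension, so there are at most
    \<open>CARD('n)\<close> of them and they can be labelled by \<open>'n\<close>.\<close>
  have "vec.dim X0 \<noteq> 0" using dim by (intro notI) (simp del: vec.dim_eq_0)
  then have "card D * 1 \<le> card D * vec.dim X0" by (intro mult_le_mono2) linarith
  then have "card D \<le> CARD('n)" using dim by linarith
  then obtain k :: "('a^'n) set \<Rightarrow> 'n" where k: "inj_on k D"
    using card_le_inj[OF finD, of "UNIV :: 'n set"] by auto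
  \<comment> \<open>Values at labels of no block are arbitrary; such labels are never reached from
    the label of a block.\<close>
  define \<phi> where "\<phi> i j = k (mimage (g i) (inv_into D k j))" for i j
  have fold: "foldr \<phi> w (k X) = k (mimage (word_mat g w) X)" if "X \<in> D" for w X
  proof (induction w)
    case (Cons i w)
    have "\<phi> i (k (mimage (word_mat g w) X)) = k (mimage (g i) (mimage (word_mat g w) X))"
      by (simp only: \<phi>_def inv_into_f_f[OF k wD[OF that]])
    then show ?case by (simp only: foldr.simps o_apply Cons word_mat.simps mimage_mult)
  qed simp
  have reach: "reach \<phi> (k X) = k ` D" if "X \<in> D" for X
    unfolding reach_def fold[OF that] trans[OF that, symmetric] by (simp add: image_image)
  have "strongly_connected \<phi> (k X0)"
    using X0 by (auto simp: strongly_connected_def reach)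
  moreover have "card (reach \<phi> (k X0)) = card D"
    by (simp add: reach[OF X0] card_image[OF k])
  moreover have "invariant_under (word_mat g ` loops \<phi> (k X0)) X0"
  proof -
    have "mimage (word_mat g w) X0 = X0" if "w \<in> loops \<phi> (k X0)" for w
      using that fold[OF X0, of w] k wD[OF X0, of w] X0 by (auto simp: loops_def inj_on_def)
    then show ?thesis unfolding invariant_under_def by blast
  qed
  ultimately show ?thesis using cD dim DD[OF X0] by (intro exI[of _ \<phi>] exI[of _ "k X0"] exI[of _ X0]) auto
qed

section \<open>Assembling the closed sets in coordinates\<close>

definition tuple_of_coords :: "('e \<times> 'n \<times> 'n \<Rightarrow> 'a) \<Rightarrow> 'e \<Rightarrow> 'a^'n^'n" where
  "tuple_of_coords x i = (\<chi> r c. x (i, r, c))"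

lemma tuple_of_coords_mat_coords [simp]: "tuple_of_coords (mat_coords g) = g"
  by (auto simp: fun_eq_iff tuple_of_coords_def mat_coords_def vec_eq_iff)

lemma polymat_word_mat:
  "polymat (\<lambda>x :: 'e \<times> 'n \<times> 'n \<Rightarrow> 'a::field. word_mat (tuple_of_coords x) w :: 'a^'n^'n)"
proof (induction w)
  case (Cons i w)
  have "polymat (\<lambda>x :: 'e \<times> 'n \<times> 'n \<Rightarrow> 'a. tuple_of_coords x i)"
    by (auto simp: polymat_def tuple_of_coords_def intro: polyfun.var)
  then show ?case using Cons by (simp add: polymat_mult)
qed (simp add: polymat_const)

text \<open>Defined for all tuples of matrices, invertible or not, so that it is closed in the
  ambient affine space.\<close>

definition small_invariant :: "'e list set \<Rightarrow> nat \<Rightarrow> ('e \<times> 'n::finite \<times> 'n \<Rightarrow> 'a::field) set" where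
  "small_invariant L d = {x. \<exists>W. vec.subspace W \<and> W \<noteq> {0} \<and> vec.dim W \<le> d \<and>
     invariant_under (word_mat (tuple_of_coords x :: 'e \<Rightarrow> 'a^'n^'n) ` L) W}"

lemma zariski_closed_small_invariant:
  assumes "alg_closed_field TYPE('a::field)"
  shows "zariski_closed (small_invariant L d :: ('e \<times> 'n::finite \<times> 'n \<Rightarrow> 'a) set)"
proof -
  let ?S = "(\<lambda>w x. word_mat (tuple_of_coords x) w :: 'a^'n^'n) ` L"
  have "zariski_closed {x :: 'e \<times> 'n \<times> 'n \<Rightarrow> 'a. \<exists>W. vec.subspace W \<and> W \<noteq> {0} \<and> vec.dim W \<le> d \<and>
      invariant_under ((\<lambda>f. f x) ` ?S) W}"
    by (rule zariski_closed_small_invariant_subspace[OF assms]) (use polymat_word_mat in auto)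
  then show ?thesis by (simp add: small_invariant_def image_image)
qed

text \<open>A reducible tuple already satisfies the first alternative, so the second need only match
  imprimitivity when the group is irreducible. The quotient in the bound encodes that the number of
  labels times \<open>vec.dim W\<close> is at most \<open>CARD('n)\<close>.\<close>

lemma not_primitive_iff:
  fixes g :: "'e \<Rightarrow> 'a::field^'n^'n"
  assumes g: "\<And>i. invertible (g i)"
  shows "\<not> acts_primitively (gen_group (range g)) \<longleftrightarrow>
    mat_coords g \<in> small_invariant UNIV (CARD('n) - 1) \<or>
    (\<exists>(\<phi> :: 'e \<Rightarrow> 'n \<Rightarrow> 'n) s. strongly_connected \<phi> s \<and> 1 < card (reach \<phi> s) \<and>
      mat_coords g \<in> small_invariant (loops \<phi> s) (CARD('n) div card (reach \<phi> s)))"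
    (is "_ \<longleftrightarrow> ?red \<or> ?imp")
proof -
  have red: "?red \<longleftrightarrow> \<not> acts_irreducibly (gen_group (range g))"
    unfolding reducible_iff_small_invariant[where g = g, OF g] by (simp add: small_invariant_def)
  have le: "d \<le> CARD('n) div c \<longleftrightarrow> c * d \<le> CARD('n)" if "1 < c" for c d :: nat
    using that by (simp add: less_eq_div_iff_mult_less_eq mult.commute)
  have "?imp \<longleftrightarrow> (\<exists>D. imprimitivity_system (gen_group (range g)) D)"
    if irr: "acts_irreducibly (gen_group (range g))"
  proof
    assume ?imp
    then obtain \<phi> :: "'e \<Rightarrow> 'n \<Rightarrow> 'n" and s W where *: "strongly_connected \<phi> s" "1 < card (reach \<phi> s)"
      "vec.subspace W" "W \<noteq> {0}" "vec.dim W \<le> CARD('n) div card (reach \<phi> s)"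
      "invariant_under (word_mat g ` loops \<phi> s) W"
      by (auto simp: small_invariant_def)
    show "\<exists>D. imprimitivity_system (gen_group (range g)) D"
      by (rule imprimitivity_system_from_loops[where g = g, OF g irr *(1-4) _ *(6)])
        (use *(5) le[OF *(2)] in simp)
  next
    assume "\<exists>D. imprimitivity_system (gen_group (range g)) D"
    then obtain D where D: "imprimitivity_system (gen_group (range g)) D" ..
    obtain \<phi> :: "'e \<Rightarrow> 'n \<Rightarrow> 'n" and s W where *: "strongly_connected \<phi> s" "1 < card (reach \<phi> s)"
      "vec.subspace W" "W \<noteq> {0}" "card (reach \<phi> s) * vec.dim W \<le> CARD('n)"
      "invariant_under (word_mat g ` loops \<phi> s) W"
      using loops_from_imprimitivity_system[where g = g, OF g irr D] by (elim exE conjE) (rule that)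
    then have "mat_coords g \<in> small_invariant (loops \<phi> s) (CARD('n) div card (reach \<phi> s))"
      using le[OF *(2)] unfolding small_invariant_def by auto
    with * show ?imp by blast
  qed
  then show ?thesis using red unfolding acts_primitively_def by blast
qed

theorem theorem2p9:
  assumes "alg_closed_field TYPE('a::field)"
  shows "zariski_open_in_GL_tuples
           {g :: 'e::finite \<Rightarrow> 'a^'n^'n. g \<in> GL_tuples \<and> acts_primitively (gen_group (range g))}"
proof -
  \<comment> \<open>\<open>I\<close> is finite because \<open>'e\<close> and \<open>'n\<close> are
    finite types, so \<open>Z\<close> is a finite union of closed sets.\<close>
  define I :: "(('e \<Rightarrow> 'n \<Rightarrow> 'n) \<times> 'n) set"
    where "I = {(\<phi>, s). strongly_connected \<phi> s \<and> 1 < card (reach \<phi> s)}"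
  define Z :: "('e \<times> 'n \<times> 'n \<Rightarrow> 'a) set"
    where "Z = small_invariant UNIV (CARD('n) - 1) \<union>
      (\<Union>(\<phi>, s)\<in>I. small_invariant (loops \<phi> s) (CARD('n) div card (reach \<phi> s)))"
  have "zariski_closed Z"
    unfolding Z_def
    by (intro zariski_closed_Un zariski_closed_UN)
      (auto intro: zariski_closed_small_invariant[OF assms])
  then have "zariski_open (- Z)" by (simp add: zariski_open_def)
  moreover have "acts_primitively (gen_group (range g)) \<longleftrightarrow> mat_coords g \<in> - Z"
    if "g \<in> GL_tuples" for g :: "'e \<Rightarrow> 'a^'n^'n"
    using that not_primitive_iff[of g] by (auto simp: GL_tuples_def Z_def I_def)
  ultimately show ?thesis
    unfolding zariski_open_in_GL_tuples_def by (intro exI[of _ "- Z"]) blast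
qed

end
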